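(* Let $P^F_c=P^F_d$, and assume that $$\tau_c\ge p_c+\lambda_c+\sqrt{4(p_c+2\lambda_c)\ln\left(\frac{1}{1-(1-P^D_{\min})^N}\right)}+2\ln\left(\frac{1}{1-(1-P^D_{\min})^N}\right),$$ where $P^D_{\min}=\min\{P^D_1,\dots,P^D_N\}$. Then $P^D_d\ge P^D_c$.
   Context: Interconnected system: for $i\in\{1,\dots,N\}$, $x_i(k+1)=A_{ii}x_i(k)+B_iu_i(k)+B^a_iu^a_i(k)+w_i(k)$, $y_i(k)=C_ix_i(k)+v_i(k)$, where $B_i=[A_{i1}\ \cdots\ A_{i,i-1}\ A_{i,i+1}\ \cdots\ A_{iN}]$ and $u_i=[x_1^{\mathsf T}\ \cdots\ x_{i-1}^{\mathsf T}\ x_{i+1}^{\mathsf T}\ \cdots\ x_N^{\mathsf T}]^{\mathsf T}$. The noises $w_i(k)\sim\mathcal N(0,\Sigma_{w_i})$ and $v_i(k)\sim\mathcal N(0,\Sigma_{v_i})$ are independent over time, of each other, and across subsystems. The initial state and the attack $u^a_i$ are deterministic. Stacking the subsystems: $x(k+1)=Ax(k)+B^au^a(k)+w(k)$, $y(k)=Cx(k)+v(k)$, with $A=[A_{ij}]_{i,j=1}^N$, $B^a=\mathrm{blkdiag}(B^a_1,\dots,B^a_N)$, $C=\mathrm{blkdiag}(C_1,\dots,C_N)$, $\Sigma_w=\mathrm{blkdiag}(\Sigma_{w_1},\dots,\Sigma_{w_N})$, $\Sigma_v=\mathrm{blkdiag}(\Sigma_{v_1},\dots,\Sigma_{v_N})$.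 Fix a horizon $T>0$. Let $Y_i=[y_i(1)^{\mathsf T}\cdots y_i(T)^{\mathsf T}]^{\mathsf T}$, $Y_c=[y(1)^{\mathsf T}\cdots y(T)^{\mathsf T}]^{\mathsf T}$; $U^a_i=[u^a_i(0)^{\mathsf T}\cdots u^a_i(T-1)^{\mathsf T}]^{\mathsf T}$, $U^a=[u^a(0)^{\mathsf T}\cdots u^a(T-1)^{\mathsf T}]^{\mathsf T}$. Define $\mathcal O_i=[(C_iA_{ii})^{\mathsf T}\cdots(C_iA_{ii}^T)^{\mathsf T}]^{\mathsf T}$, and let $\mathcal F^{(a)}_i,\mathcal F^{(u)}_i,\mathcal F^{(w)}_i$ be the $T\times T$ block matrices whose $(j,l)$ block is, for $j\ge l$, $C_iA_{ii}^{j-l}B^a_i$, $C_iA_{ii}^{j-l}B_i$, $C_iA_{ii}^{j-l}$ respectively, and $0$ for $j<l$. Let $\mathcal O_c,\mathcal F^{(a)}_c,\mathcal F^{(w)}_c$ be defined as $\mathcal O_i,\mathcal F^{(a)}_i,\mathcal F^{(w)}_i$ with $A_{ii},B^a_i,C_i$ replaced by $A,B^a,C$. Let the rows of $N_i$ form a basis of the left null space of $[\mathcal O_i\ \ \mathcal F^{(u)}_i]$ and the rows of $N_c$ a basis of the left null space of $\mathcal O_c$ (these null spaces are nontrivial). Set $\widetilde Y_i=N_iY_i$, $\widetilde Y_c=N_cY_c$, which are Gaussian with means $\beta_i=N_i\mathcal F^{(a)}_iU^a_i$, $\beta_c=N_c\mathcal F^{(a)}_cU^a$ and covariances $\Sigma_i=N_i[\mathcal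 F^{(w)}_i(I_T\otimes\Sigma_{w_i})(\mathcal F^{(w)}_i)^{\mathsf T}+(I_T\otimes\Sigma_{v_i})]N_i^{\mathsf T}$, $\Sigma_c=N_c[\mathcal F^{(w)}_c(I_T\otimes\Sigma_w)(\mathcal F^{(w)}_c)^{\mathsf T}+(I_T\otimes\Sigma_v)]N_c^{\mathsf T}$, assumed invertible. Set $p_i=\mathrm{Rank}(\Sigma_i)$, $p_c=\mathrm{Rank}(\Sigma_c)$, $\lambda_i=\beta_i^{\mathsf T}\Sigma_i^{-1}\beta_i$, $\lambda_c=\beta_c^{\mathsf T}\Sigma_c^{-1}\beta_c$. Detectors: with thresholds $\tau_i,\tau_c\ge0$, the $i$-th local detector raises an alarm if $\Lambda_i:=\widetilde Y_i^{\mathsf T}\Sigma_i^{-1}\widetilde Y_i\ge\tau_i$; the centralized detector raises an alarm if $\Lambda_c:=\widetilde Y_c^{\mathsf T}\Sigma_c^{-1}\widetilde Y_c\ge\tau_c$; the decentralized detector raises an alarm if at least one local detector does. $H_0$: no attack (means equal to zero). $H_1$: the system is under the fixed deterministic attack $U^a$. False alarm and detection probabilities are the alarm probabilities under $H_0$ and $H_1$ respectively: $P^F_i=\Pr[\Lambda_i\ge\tau_i|H_0]=Q(\tau_i;p_i,0)$, $P^D_i=\Pr[\Lambda_i\ge\tau_i|H_1]=Q(\tau_i;p_i,\lambda_i)$, $P^F_c=\Pr[\Lambda_c\ge\tau_c|H_0]=Q(\tau_c;p_c,0)$, $P^D_c=\Pr[\Lambda_c\ge\tau_c|H_1]=Q(\tau_c;p_c,\lambda_c)$,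 $P^F_d=\Pr[\Lambda_i\ge\tau_i\text{ for some }i|H_0]$, $P^D_d=\Pr[\Lambda_i\ge\tau_i\text{ for some }i|H_1]$. Here $Q(\tau;p,\lambda)$ is the complementary cumulative distribution function at $\tau$ of the noncentral chi-squared distribution with $p$ degrees of freedom and noncentrality parameter $\lambda$. *)

theory Defs
  imports
    "HOL-Probability.Probability"
    "Jordan_Normal_Form.Matrix_Kernel"
    "Jordan_Normal_Form.Gauss_Jordan_Elimination"
    "Jordan_Normal_Form.DL_Rank"
begin

unbundle no vec_syntax
unbundle no inner_syntax

definition vstack :: "real vec list \<Rightarrow> real vec" where
  "vstack vs = foldr (@\<^sub>v) vs (0\<^sub>v 0)"

text \<open>The extra argument is the common number of columns (resp. rows) of the blocks; it only
  matters for an empty list of blocks.\<close>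

definition vcat :: "nat \<Rightarrow> real mat list \<Rightarrow> real mat" where
  "vcat nc Ms = foldr (@\<^sub>r) Ms (0\<^sub>m 0 nc)"

definition hcat :: "nat \<Rightarrow> real mat list \<Rightarrow> real mat" where
  "hcat nr Ms = transpose_mat (vcat nr (map transpose_mat Ms))"

text \<open>\<open>T \<times> T\<close> block matrix whose \<open>(j, l)\<close> block is \<open>G (j - l)\<close> for \<open>j \<ge> l\<close> and \<open>0\<close> otherwise;
  every block has size \<open>nr \<times> nc\<close>.\<close>

definition block_toeplitz :: "nat \<Rightarrow> nat \<Rightarrow> nat \<Rightarrow> (nat \<Rightarrow> real mat) \<Rightarrow> real mat" where
  "block_toeplitz T nr nc G =
     vcat (T * nc) (map (\<lambda>j. hcat nr (map (\<lambda>l. if l \<le> j then G (j - l) else 0\<^sub>m nr nc) [0..<T])) [0..<T])"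

text \<open>\<open>repeat_diag T S\<close> is the Kronecker product of the \<open>T \<times> T\<close> identity matrix with \<open>S\<close>.\<close>

definition repeat_diag :: "nat \<Rightarrow> real mat \<Rightarrow> real mat" where
  "repeat_diag T S = diag_block_mat (replicate T S)"

text \<open>Meaningful for invertible matrices only, where \<open>mat_inverse\<close> is not \<open>None\<close>.\<close>

definition mat_inv :: "real mat \<Rightarrow> real mat" where
  "mat_inv S = the (mat_inverse S)"

definition mat_rank :: "real mat \<Rightarrow> nat" where
  "mat_rank S = vec_space.rank (dim_row S) S"

definition inv_quad :: "real mat \<Rightarrow> real vec \<Rightarrow> real" where
  "inv_quad S y = y \<bullet> (mat_inv S *\<^sub>v y)"

text \<open>The left null space of \<open>K\<close> is the kernel of its transpose. As \<open>kernel.basis\<close> speaks about a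
  set of vectors, distinctness of the rows is required separately.\<close>

definition left_null_basis :: "real mat \<Rightarrow> real mat \<Rightarrow> bool" where
  "left_null_basis R K \<longleftrightarrow>
     dim_col R = dim_row K \<and> distinct (rows R) \<and>
     kernel.basis (dim_row K) (transpose_mat K) (set (rows R))"

definition left_null_nontrivial :: "real mat \<Rightarrow> bool" where
  "left_null_nontrivial K \<longleftrightarrow> mat_kernel (transpose_mat K) \<noteq> {0\<^sub>v (dim_row K)}"

definition has_normal_law :: "'w measure \<Rightarrow> ('w \<Rightarrow> real) \<Rightarrow> real \<Rightarrow> real \<Rightarrow> bool" where
  "has_normal_law M X m s \<longleftrightarrow>
     (if s = 0 then X \<in> borel_measurable M \<and> (AE \<omega> in M. X \<omega> = m)
      else s > 0 \<and> distributed M lborel X (normal_density m (sqrt s)))"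

text \<open>\<open>X\<close> has the law \<open>N(\<mu>, S)\<close> iff every linear functional \<open>a \<bullet> X\<close> has the univariate law
  \<open>N(a \<bullet> \<mu>, a \<bullet> S a)\<close>, where the normal law of variance 0 is a point mass. The covariance matrix may
  be singular.\<close>

definition gaussian_vec ::
  "'w measure \<Rightarrow> nat \<Rightarrow> ('w \<Rightarrow> real vec) \<Rightarrow> real vec \<Rightarrow> real mat \<Rightarrow> bool" where
  "gaussian_vec M n X \<mu> S \<longleftrightarrow>
     \<mu> \<in> carrier_vec n \<and> S \<in> carrier_mat n n \<and> transpose_mat S = S \<and>
     (\<forall>\<omega>\<in>space M. X \<omega> \<in> carrier_vec n) \<and>
     (\<forall>a\<in>carrier_vec n. has_normal_law M (\<lambda>\<omega>. a \<bullet> X \<omega>) (a \<bullet> \<mu>) (a \<bullet> (S *\<^sub>v a)))"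

text \<open>Subsystems are numbered \<open>0, \<dots>, N - 1\<close>. For subsystem \<open>i\<close>: \<open>xdim\<close>, \<open>adim\<close>, \<open>ydim\<close> are the
  dimensions of state, attack input and output, \<open>Amat i j\<close> is the block \<open>A\<^sub>i\<^sub>j\<close>, and \<open>Wcov\<close>, \<open>Vcov\<close>
  are the covariances of process and measurement noise.\<close>

record plant =
  nsub :: nat
  xdim :: "nat \<Rightarrow> nat"
  adim :: "nat \<Rightarrow> nat"
  ydim :: "nat \<Rightarrow> nat"
  Amat :: "nat \<Rightarrow> nat \<Rightarrow> real mat"
  Bmat :: "nat \<Rightarrow> real mat"
  Cmat :: "nat \<Rightarrow> real mat"
  Wcov :: "nat \<Rightarrow> real mat"
  Vcov :: "nat \<Rightarrow> real mat"
  xini :: "nat \<Rightarrow> real vec"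

definition plant_dims :: "plant \<Rightarrow> bool" where
  "plant_dims P \<longleftrightarrow> nsub P > 0 \<and>
     (\<forall>i<nsub P.
        (\<forall>j<nsub P. Amat P i j \<in> carrier_mat (xdim P i) (xdim P j)) \<and>
        Bmat P i \<in> carrier_mat (xdim P i) (adim P i) \<and>
        Cmat P i \<in> carrier_mat (ydim P i) (xdim P i) \<and>
        Wcov P i \<in> carrier_mat (xdim P i) (xdim P i) \<and>
        Vcov P i \<in> carrier_mat (ydim P i) (ydim P i) \<and>
        xini P i \<in> carrier_vec (xdim P i))"

text \<open>Noise processes and attacks take the subsystem first and the time second.\<close>

type_synonym 'w noise = "nat \<Rightarrow> nat \<Rightarrow> 'w \<Rightarrow> real vec"
type_synonym attack = "nat \<Rightarrow> nat \<Rightarrow> real vec"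

definition attack_dims :: "plant \<Rightarrow> attack \<Rightarrow> bool" where
  "attack_dims P ua \<longleftrightarrow> (\<forall>i<nsub P. \<forall>k. ua i k \<in> carrier_vec (adim P i))"

definition no_attack :: "plant \<Rightarrow> attack" where
  "no_attack P i k = 0\<^sub>v (adim P i)"

text \<open>Independence is joint over the whole family of vectors \<open>w i k\<close> and \<open>v i k\<close>; a random vector is
  turned into an element of a product space of copies of the real line to have a \<open>\<sigma>\<close>-algebra.\<close>

definition vec_fun :: "nat \<Rightarrow> real vec \<Rightarrow> nat \<Rightarrow> real" where
  "vec_fun n x = (\<lambda>j\<in>{..<n}. x $ j)"

definition noise_model :: "'w measure \<Rightarrow> plant \<Rightarrow> 'w noise \<Rightarrow> 'w noise \<Rightarrow> bool" where
  "noise_model M P w v \<longleftrightarrow>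
     (\<forall>i<nsub P. \<forall>k. gaussian_vec M (xdim P i) (w i k) (0\<^sub>v (xdim P i)) (Wcov P i)) \<and>
     (\<forall>i<nsub P. \<forall>k. gaussian_vec M (ydim P i) (v i k) (0\<^sub>v (ydim P i)) (Vcov P i)) \<and>
     prob_space.indep_vars M
       (case_sum (\<lambda>(i, k). Pi\<^sub>M {..<xdim P i} (\<lambda>_. borel)) (\<lambda>(i, k). Pi\<^sub>M {..<ydim P i} (\<lambda>_. borel)))
       (case_sum (\<lambda>(i, k) \<omega>. vec_fun (xdim P i) (w i k \<omega>)) (\<lambda>(i, k) \<omega>. vec_fun (ydim P i) (v i k \<omega>)))
       (({..<nsub P} \<times> UNIV) <+> ({..<nsub P} \<times> UNIV))"

definition others :: "plant \<Rightarrow> nat \<Rightarrow> nat list" where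
  "others P i = filter (\<lambda>j. j \<noteq> i) [0..<nsub P]"

definition Bint :: "plant \<Rightarrow> nat \<Rightarrow> real mat" where
  "Bint P i = hcat (xdim P i) (map (Amat P i) (others P i))"

primrec state :: "plant \<Rightarrow> attack \<Rightarrow> 'w noise \<Rightarrow> nat \<Rightarrow> nat \<Rightarrow> 'w \<Rightarrow> real vec" where
  "state P ua w 0 i \<omega> = xini P i"
| "state P ua w (Suc k) i \<omega> =
     Amat P i i *\<^sub>v state P ua w k i \<omega>
     + Bint P i *\<^sub>v vstack (map (\<lambda>j. state P ua w k j \<omega>) (others P i))
     + Bmat P i *\<^sub>v ua i k + w i k \<omega>"

definition meas :: "plant \<Rightarrow> attack \<Rightarrow> 'w noise \<Rightarrow> 'w noise \<Rightarrow> nat \<Rightarrow> nat \<Rightarrow> 'w \<Rightarrow> real vec" where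
  "meas P ua w v i k \<omega> = Cmat P i *\<^sub>v state P ua w k i \<omega> + v i k \<omega>"

text \<open>\<open>n\<close>, \<open>m\<close>, \<open>r\<close> are the numbers of states, inputs and outputs. The matrices below are
  instantiated both with a single subsystem and with the stacked system.\<close>

definition obs_mat :: "nat \<Rightarrow> nat \<Rightarrow> real mat \<Rightarrow> real mat \<Rightarrow> real mat" where
  "obs_mat T n A C = vcat n (map (\<lambda>j. C * A ^\<^sub>m j) [1..<T+1])"

definition input_mat :: "nat \<Rightarrow> nat \<Rightarrow> nat \<Rightarrow> real mat \<Rightarrow> real mat \<Rightarrow> real mat \<Rightarrow> real mat" where
  "input_mat T r m A C B = block_toeplitz T r m (\<lambda>d. C * A ^\<^sub>m d * B)"

definition noise_mat :: "nat \<Rightarrow> nat \<Rightarrow> nat \<Rightarrow> real mat \<Rightarrow> real mat \<Rightarrow> real mat" where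
  "noise_mat T r n A C = block_toeplitz T r n (\<lambda>d. C * A ^\<^sub>m d)"

definition resid_cov ::
  "nat \<Rightarrow> nat \<Rightarrow> nat \<Rightarrow> real mat \<Rightarrow> real mat \<Rightarrow> real mat \<Rightarrow> real mat \<Rightarrow> real mat \<Rightarrow> real mat" where
  "resid_cov T n r A C Sw Sv R =
     (let F = noise_mat T r n A C
      in R * (F * repeat_diag T Sw * transpose_mat F + repeat_diag T Sv) * transpose_mat R)"

definition xsum :: "plant \<Rightarrow> nat" where "xsum P = (\<Sum>i<nsub P. xdim P i)"
definition asum :: "plant \<Rightarrow> nat" where "asum P = (\<Sum>i<nsub P. adim P i)"
definition ysum :: "plant \<Rightarrow> nat" where "ysum P = (\<Sum>i<nsub P. ydim P i)"

definition blkdiag :: "plant \<Rightarrow> (nat \<Rightarrow> real mat) \<Rightarrow> real mat" where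
  "blkdiag P D = diag_block_mat (map D [0..<nsub P])"

definition Aall :: "plant \<Rightarrow> real mat" where
  "Aall P = vcat (xsum P) (map (\<lambda>i. hcat (xdim P i) (map (Amat P i) [0..<nsub P])) [0..<nsub P])"

text \<open>The left null spaces of \<open>loc_mat\<close> and \<open>cen_mat\<close> contain the filters of the local and the
  centralized detector: the local detector eliminates the initial state and the interconnection
  signal, the centralized one the initial state.\<close>

definition loc_mat :: "plant \<Rightarrow> nat \<Rightarrow> nat \<Rightarrow> real mat" where
  "loc_mat P T i =
     hcat (T * ydim P i)
       [obs_mat T (xdim P i) (Amat P i i) (Cmat P i),
        input_mat T (ydim P i) (sum_list (map (xdim P) (others P i))) (Amat P i i) (Cmat P i) (Bint P i)]"

definition cen_mat :: "plant \<Rightarrow> nat \<Rightarrow> real mat" where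
  "cen_mat P T = obs_mat T (xsum P) (Aall P) (blkdiag P (Cmat P))"

definition loc_cov :: "plant \<Rightarrow> nat \<Rightarrow> nat \<Rightarrow> real mat \<Rightarrow> real mat" where
  "loc_cov P T i R =
     resid_cov T (xdim P i) (ydim P i) (Amat P i i) (Cmat P i) (Wcov P i) (Vcov P i) R"

definition cen_cov :: "plant \<Rightarrow> nat \<Rightarrow> real mat \<Rightarrow> real mat" where
  "cen_cov P T R =
     resid_cov T (xsum P) (ysum P) (Aall P) (blkdiag P (Cmat P)) (blkdiag P (Wcov P)) (blkdiag P (Vcov P)) R"

definition loc_stat ::
  "plant \<Rightarrow> nat \<Rightarrow> attack \<Rightarrow> 'w noise \<Rightarrow> 'w noise \<Rightarrow> real mat \<Rightarrow> nat \<Rightarrow> 'w \<Rightarrow> real" where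
  "loc_stat P T ua w v R i \<omega> =
     inv_quad (loc_cov P T i R)
       (R *\<^sub>v vstack (map (\<lambda>k. meas P ua w v i k \<omega>) [1..<T+1]))"

definition cen_stat ::
  "plant \<Rightarrow> nat \<Rightarrow> attack \<Rightarrow> 'w noise \<Rightarrow> 'w noise \<Rightarrow> real mat \<Rightarrow> 'w \<Rightarrow> real" where
  "cen_stat P T ua w v R \<omega> =
     inv_quad (cen_cov P T R)
       (R *\<^sub>v vstack (map (\<lambda>k. vstack (map (\<lambda>i. meas P ua w v i k \<omega>) [0..<nsub P])) [1..<T+1]))"

definition cen_dof :: "plant \<Rightarrow> nat \<Rightarrow> real mat \<Rightarrow> nat" where
  "cen_dof P T R = mat_rank (cen_cov P T R)"

definition cen_mean :: "plant \<Rightarrow> nat \<Rightarrow> attack \<Rightarrow> real mat \<Rightarrow> real vec" where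
  "cen_mean P T ua R =
     R *\<^sub>v (input_mat T (ysum P) (asum P) (Aall P) (blkdiag P (Cmat P)) (blkdiag P (Bmat P))
       *\<^sub>v vstack (map (\<lambda>k. vstack (map (\<lambda>i. ua i k) [0..<nsub P])) [0..<T]))"

definition cen_noncentrality :: "plant \<Rightarrow> nat \<Rightarrow> attack \<Rightarrow> real mat \<Rightarrow> real" where
  "cen_noncentrality P T ua R = inv_quad (cen_cov P T R) (cen_mean P T ua R)"

text \<open>With the attack \<open>ua\<close> in force these are the detection probabilities, with \<open>no_attack P\<close> in
  its place the false alarm probabilities.\<close>

definition loc_alarm_prob ::
  "'w measure \<Rightarrow> plant \<Rightarrow> nat \<Rightarrow> attack \<Rightarrow> 'w noise \<Rightarrow> 'w noise \<Rightarrow> (nat \<Rightarrow> real mat) \<Rightarrow> (nat \<Rightarrow> real)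
    \<Rightarrow> nat \<Rightarrow> real" where
  "loc_alarm_prob M P T ua w v NL \<tau> i =
     measure M {\<omega> \<in> space M. loc_stat P T ua w v (NL i) i \<omega> \<ge> \<tau> i}"

definition dec_alarm_prob ::
  "'w measure \<Rightarrow> plant \<Rightarrow> nat \<Rightarrow> attack \<Rightarrow> 'w noise \<Rightarrow> 'w noise \<Rightarrow> (nat \<Rightarrow> real mat) \<Rightarrow> (nat \<Rightarrow> real)
    \<Rightarrow> real" where
  "dec_alarm_prob M P T ua w v NL \<tau> =
     measure M {\<omega> \<in> space M. \<exists>i<nsub P. loc_stat P T ua w v (NL i) i \<omega> \<ge> \<tau> i}"

definition cen_alarm_prob ::
  "'w measure \<Rightarrow> plant \<Rightarrow> nat \<Rightarrow> attack \<Rightarrow> 'w noise \<Rightarrow> 'w noise \<Rightarrow> real mat \<Rightarrow> real \<Rightarrow> real" where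
  "cen_alarm_prob M P T ua w v NC \<tau>c =
     measure M {\<omega> \<in> space M. cen_stat P T ua w v NC \<omega> \<ge> \<tau>c}"

definition min_detection_prob ::
  "'w measure \<Rightarrow> plant \<Rightarrow> nat \<Rightarrow> attack \<Rightarrow> 'w noise \<Rightarrow> 'w noise \<Rightarrow> (nat \<Rightarrow> real mat) \<Rightarrow> (nat \<Rightarrow> real)
    \<Rightarrow> real" where
  "min_detection_prob M P T ua w v NL \<tau> = (MIN i\<in>{..<nsub P}. loc_alarm_prob M P T ua w v NL \<tau> i)"

end

theory Submission
  imports Defs
begin

text \<open>The argument rests on a comparison of two numbers. Put
  \<open>x = 1 - (1 - p)\<^sup>N\<close>, where \<open>p\<close> is the least of the \<open>N\<close> local detection probabilities.

  The decentralized detector detects with probability at least \<open>x\<close>. Since the rows of the \<open>i\<close>-th local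
  filter annihilate the contributions of the initial state and of the interconnection signal, the
  \<open>i\<close>-th filtered output is its mean under the attack plus a linear function of the noises of
  subsystem \<open>i\<close> alone (\<open>local_residual\<close>). Different subsystems have independent noises, so the local
  alarms are independent and the probability that none is raised is \<open>\<Prod>i. 1 - p\<^sub>i \<le> (1 - p)\<^sup>N\<close>
  (\<open>local_statistics_indep\<close>).

  The centralized detector detects with probability at most \<open>x\<close>. Its statistic follows a noncentral
  chi-squared law with \<open>p\<^sub>c\<close> degrees of freedom and noncentrality \<open>\<lambda>\<^sub>c\<close>, whose upper tail satisfies
  Birge's inequality: the value \<open>p\<^sub>c + \<lambda>\<^sub>c + 2 sqrt ((p\<^sub>c + 2 \<lambda>\<^sub>c) t) + 2 t\<close> is exceeded with probability
  at most \<open>exp (- t)\<close> (\<open>sum_squares_tail\<close>, \<open>statistic_tail\<close>). The assumed lower bound of the threshold is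
  this value for \<open>t = ln (1 / x)\<close>, that is \<open>exp (- t) = x\<close>. The last equation requires \<open>x > 0\<close>, hence
  \<open>p > 0\<close>, which holds because a nondegenerate Gaussian vector is unbounded
  (\<open>statistic_large_pos\<close>).

  The law of a residual \<open>r\<close> enters through the moments
  \<open>E exp (a \<bullet> r) = exp (a \<bullet> \<beta> + a \<bullet> S a / 2)\<close> for all vectors \<open>a\<close> (\<open>residual_exp\<close>), which follows from
  the independence of the noises. If \<open>q\<^sub>j\<close> are orthonormal with respect to the covariance \<open>S\<close>, then
  the statistic is \<open>\<Sum>j. (q\<^sub>j \<bullet> r)\<^sup>2\<close>, and its exponential moments come from those of linear functionals
  by writing each \<open>exp (s z\<^sup>2)\<close> as a Gaussian average of \<open>exp (sqrt (2 s) g z)\<close>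
  (\<open>nn_integral_exp_sum_squares\<close>).\<close>

section \<open>Stacked vectors and block matrices\<close>

text \<open>Identities between block vectors are proved below by pairing both sides with a test vector: pairing
  turns stacking into summation and moves a matrix to the other side as its transpose, so that no
  index arithmetic on blocks is needed.\<close>

lemma vec_eqI_scalar_prod:
  fixes u v :: "real vec"
  assumes "u \<in> carrier_vec n" "v \<in> carrier_vec n" "\<And>a. a \<in> carrier_vec n \<Longrightarrow> a \<bullet> u = a \<bullet> v"
  shows "u = v"
proof (rule eq_vecI)
  fix i assume "i < dim_vec v"
  with assms(2) have i: "i < n" by auto
  show "u $ i = v $ i"
    using assms(3)[of "unit_vec n i"] i assms(1,2) by simp
qed (use assms in auto)

lemma zero_mat_mult_vector: "x \<in> carrier_vec n \<Longrightarrow> 0\<^sub>m m n *\<^sub>v x = (0\<^sub>v m :: real vec)"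
  by (intro eq_vecI) auto

lemma sum_list_map_upt: "(\<Sum>k\<leftarrow>[m..<n]. f k) = sum f {m..<n}" for f :: "nat \<Rightarrow> 'a::comm_monoid_add"
  by (simp add: sum_list_distinct_conv_sum_set)

lemma vstack_simps [simp]: "vstack [] = 0\<^sub>v 0" "vstack (x # xs) = x @\<^sub>v vstack xs"
  by (simp_all add: vstack_def)

lemma vstack_carrier:
  assumes "\<And>k. k \<in> set ks \<Longrightarrow> f k \<in> carrier_vec (d k)"
  shows "vstack (map f ks) \<in> carrier_vec (\<Sum>k\<leftarrow>ks. d k)"
  using assms by (induction ks) auto

lemma vstack_scalar_prod:
  fixes f g :: "'b \<Rightarrow> real vec"
  assumes "\<And>k. k \<in> set ks \<Longrightarrow> f k \<in> carrier_vec (d k)" "\<And>k. k \<in> set ks \<Longrightarrow> g k \<in> carrier_vec (d k)"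
  shows "vstack (map f ks) \<bullet> vstack (map g ks) = (\<Sum>k\<leftarrow>ks. f k \<bullet> g k)"
  using assms
proof (induction ks)
  case (Cons k ks)
  have "vstack (map f ks) \<in> carrier_vec (\<Sum>k\<leftarrow>ks. d k)" "vstack (map g ks) \<in> carrier_vec (\<Sum>k\<leftarrow>ks. d k)"
    using Cons.prems by (auto intro!: vstack_carrier)
  with Cons show ?case
    by (simp add: scalar_prod_append[of _ "d k" _ "\<Sum>k\<leftarrow>ks. d k"])
qed simp

lemma vstack_add:
  assumes "\<And>k. k \<in> set ks \<Longrightarrow> f k \<in> carrier_vec (d k)" "\<And>k. k \<in> set ks \<Longrightarrow> g k \<in> carrier_vec (d k)"
  shows "vstack (map (\<lambda>k. f k + g k) ks) = vstack (map f ks) + vstack (map g ks)"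
  using assms
proof (induction ks)
  case (Cons k ks)
  have "vstack (map f ks) \<in> carrier_vec (\<Sum>k\<leftarrow>ks. d k)" "vstack (map g ks) \<in> carrier_vec (\<Sum>k\<leftarrow>ks. d k)"
    using Cons.prems by (auto intro!: vstack_carrier)
  with Cons show ?case
    by (simp add: append_vec_add[of _ "d k" _ _ "\<Sum>k\<leftarrow>ks. d k"])
qed auto

lemma vstack_exhaust:
  assumes "b \<in> carrier_vec (\<Sum>k\<leftarrow>ks. d k)" "distinct ks"
  obtains f where "\<And>k. k \<in> set ks \<Longrightarrow> f k \<in> carrier_vec (d k)" "b = vstack (map f ks)"
proof -
  have "\<exists>f. (\<forall>k\<in>set ks. f k \<in> carrier_vec (d k)) \<and> b = vstack (map f ks)"
    using assms
  proof (induction ks arbitrary: b)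
    case Nil
    then show ?case by auto
  next
    case (Cons k ks)
    let ?n = "\<Sum>k\<leftarrow>ks. d k"
    have "vec_last b ?n \<in> carrier_vec ?n" "distinct ks" using Cons.prems by auto
    from Cons.IH[OF this] obtain f where f: "\<forall>k\<in>set ks. f k \<in> carrier_vec (d k)"
      "vec_last b ?n = vstack (map f ks)" by blast
    let ?f = "f(k := vec_first b (d k))"
    have "map ?f (k # ks) = vec_first b (d k) # map f ks" using Cons.prems by auto
    moreover have "vec_first b (d k) @\<^sub>v vec_last b ?n = b"
      using Cons.prems by simp
    ultimately show ?case
      using f by (intro exI[of _ ?f] conjI) (simp, simp only: vstack_simps)
  qed
  with that show thesis by blast
qed

lemma vcat_simps [simp]: "vcat n [] = 0\<^sub>m 0 n" "vcat n (M # Ms) = M @\<^sub>r vcat n Ms"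
  by (simp_all add: vcat_def)

lemma vcat_carrier:
  assumes "\<And>k. k \<in> set ks \<Longrightarrow> M k \<in> carrier_mat (d k) n"
  shows "vcat n (map M ks) \<in> carrier_mat (\<Sum>k\<leftarrow>ks. d k) n"
  using assms by (induction ks) auto

lemma vcat_mult_vec:
  assumes "\<And>k. k \<in> set ks \<Longrightarrow> M k \<in> carrier_mat (d k) n" "x \<in> carrier_vec n"
  shows "vcat n (map M ks) *\<^sub>v x = vstack (map (\<lambda>k. M k *\<^sub>v x) ks)"
  using assms(1)
proof (induction ks)
  case (Cons k ks)
  have "vcat n (map M ks) \<in> carrier_mat (\<Sum>k\<leftarrow>ks. d k) n" using Cons.prems by (auto intro!: vcat_carrier)
  with Cons assms(2) show ?case by (simp add: mat_mult_append[of _ "d k" n])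
qed (use assms(2) in auto)

lemma hcat_carrier:
  assumes "\<And>k. k \<in> set ks \<Longrightarrow> M k \<in> carrier_mat n (d k)"
  shows "hcat n (map M ks) \<in> carrier_mat n (\<Sum>k\<leftarrow>ks. d k)"
  using vcat_carrier[of ks "transpose_mat \<circ> M" d n] assms by (auto simp: hcat_def)

text \<open>The transpose of a horizontal concatenation is a vertical one, which acts block by block.\<close>

lemma hcat_scalar_prod:
  assumes M: "\<And>k. k \<in> set ks \<Longrightarrow> M k \<in> carrier_mat n (d k)"
    and x: "\<And>k. k \<in> set ks \<Longrightarrow> x k \<in> carrier_vec (d k)" and y: "y \<in> carrier_vec n"
  shows "y \<bullet> (hcat n (map M ks) *\<^sub>v vstack (map x ks)) = (\<Sum>k\<leftarrow>ks. y \<bullet> (M k *\<^sub>v x k))"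
proof -
  have "y \<bullet> (hcat n (map M ks) *\<^sub>v vstack (map x ks))
    = (transpose_mat (hcat n (map M ks)) *\<^sub>v y) \<bullet> vstack (map x ks)"
    using transpose_vec_mult_scalar[of "hcat n (map M ks)", OF hcat_carrier vstack_carrier y] M x by metis
  also have "transpose_mat (hcat n (map M ks)) *\<^sub>v y = vstack (map (\<lambda>k. transpose_mat (M k) *\<^sub>v y) ks)"
    using vcat_mult_vec[of ks "transpose_mat \<circ> M" d n y] M y by (simp add: hcat_def)
  also have "\<dots> \<bullet> vstack (map x ks) = (\<Sum>k\<leftarrow>ks. (transpose_mat (M k) *\<^sub>v y) \<bullet> x k)"
    by (rule vstack_scalar_prod[where d = d]) (use M x y in \<open>auto intro!: mult_mat_vec_carrier\<close>)
  also have "\<dots> = (\<Sum>k\<leftarrow>ks. y \<bullet> (M k *\<^sub>v x k))"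
    using transpose_vec_mult_scalar[OF M x y] by (simp cong: map_cong)
  finally show ?thesis .
qed

lemma diag_block_mat_carrier:
  assumes "\<And>k. k \<in> set ks \<Longrightarrow> M k \<in> carrier_mat (r k) (c k)"
  shows "diag_block_mat (map M ks) \<in> carrier_mat (\<Sum>k\<leftarrow>ks. r k) (\<Sum>k\<leftarrow>ks. c k)"
proof -
  have "dim_row (M k) = r k" "dim_col (M k) = c k" if "k \<in> set ks" for k
    using assms[OF that] by auto
  then show ?thesis
    by (intro carrier_matI) (simp_all add: dim_diag_block_mat o_def cong: map_cong)
qed

lemma diag_block_mat_mult_vec:
  fixes M :: "'b \<Rightarrow> real mat"
  assumes "\<And>k. k \<in> set ks \<Longrightarrow> M k \<in> carrier_mat (r k) (c k)" "\<And>k. k \<in> set ks \<Longrightarrow> x k \<in> carrier_vec (c k)"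
  shows "diag_block_mat (map M ks) *\<^sub>v vstack (map x ks) = vstack (map (\<lambda>k. M k *\<^sub>v x k) ks)"
  using assms
proof (induction ks)
  case (Cons k ks)
  let ?m = "\<Sum>k\<leftarrow>ks. r k" and ?n = "\<Sum>k\<leftarrow>ks. c k"
  have D: "diag_block_mat (map M ks) \<in> carrier_mat ?m ?n" using Cons.prems by (auto intro!: diag_block_mat_carrier)
  have X: "vstack (map x ks) \<in> carrier_vec ?n" using Cons.prems by (auto intro!: vstack_carrier)
  have Mk: "M k \<in> carrier_mat (r k) (c k)" "x k \<in> carrier_vec (c k)" using Cons.prems by auto
  have "diag_block_mat (map M (k # ks)) *\<^sub>v vstack (map x (k # ks)) =
     four_block_mat (M k) (0\<^sub>m (r k) ?n) (0\<^sub>m ?m (c k)) (diag_block_mat (map M ks)) *\<^sub>v (x k @\<^sub>v vstack (map x ks))"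
    using D Mk by (simp add: Let_def)
  also have "\<dots> = (M k *\<^sub>v x k + 0\<^sub>m (r k) ?n *\<^sub>v vstack (map x ks)) @\<^sub>v
       (0\<^sub>m ?m (c k) *\<^sub>v x k + diag_block_mat (map M ks) *\<^sub>v vstack (map x ks))"
    by (rule four_block_mat_mult_vec[OF Mk(1) _ _ D Mk(2) X]) auto
  also have "\<dots> = M k *\<^sub>v x k @\<^sub>v diag_block_mat (map M ks) *\<^sub>v vstack (map x ks)"
    using Mk X D by (simp add: zero_mat_mult_vector)
  finally show ?case
    using Cons by auto
qed auto

lemma transpose_diag_block_mat:
  "transpose_mat (diag_block_mat Ms) = diag_block_mat (map transpose_mat Ms)"
proof (induction Ms)
  case (Cons M Ms)
  show ?case
    by (simp add: Let_def Cons[symmetric], subst transpose_four_block_mat[of _ "dim_row M" "dim_col M" _ "dim_col (diag_block_mat Ms)" _ "dim_row (diag_block_mat Ms)"]) auto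
qed auto

lemma diag_block_mat_quad:
  fixes M :: "'b \<Rightarrow> real mat"
  assumes "\<And>k. k \<in> set ks \<Longrightarrow> M k \<in> carrier_mat (d k) (d k)" "\<And>k. k \<in> set ks \<Longrightarrow> x k \<in> carrier_vec (d k)"
  shows "vstack (map x ks) \<bullet> (diag_block_mat (map M ks) *\<^sub>v vstack (map x ks)) = (\<Sum>k\<leftarrow>ks. x k \<bullet> (M k *\<^sub>v x k))"
  by (subst diag_block_mat_mult_vec[where r = d and c = d], use assms in simp, use assms in simp,
      rule vstack_scalar_prod[where d = d]) (use assms in \<open>auto intro!: mult_mat_vec_carrier\<close>)

lemma repeat_diag_eq: "repeat_diag T S = diag_block_mat (map (\<lambda>_. S) [0..<T])"
  by (simp add: repeat_diag_def map_replicate_const)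

lemma mult_mat_vec_scalar_prod_shift:
  fixes A :: "real mat"
  assumes "A \<in> carrier_mat m n" "x \<in> carrier_vec n" "y \<in> carrier_vec m"
  shows "y \<bullet> (A *\<^sub>v x) = (transpose_mat A *\<^sub>v y) \<bullet> x"
  using transpose_vec_mult_scalar[OF assms] by simp

lemma sum_list_const_nat: "(\<Sum>k\<leftarrow>[m..<n]. c) = (n - m) * (c::nat)"
  by (simp add: sum_list_triv)

lemma block_toeplitz_carrier:
  assumes "\<And>d. d < T \<Longrightarrow> G d \<in> carrier_mat nr nc"
  shows "block_toeplitz T nr nc G \<in> carrier_mat (T * nr) (T * nc)"
proof -
  have "hcat nr (map (\<lambda>l. if l \<le> j then G (j - l) else 0\<^sub>m nr nc) [0..<T]) \<in> carrier_mat nr (T * nc)" if "j < T" for j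
    using hcat_carrier[of "[0..<T]" "\<lambda>l. if l \<le> j then G (j - l) else 0\<^sub>m nr nc" nr "\<lambda>_. nc"] assms that
    by (auto simp: sum_list_const_nat)
  from vcat_carrier[of "[0..<T]" "\<lambda>j. hcat nr (map (\<lambda>l. if l \<le> j then G (j - l) else 0\<^sub>m nr nc) [0..<T])" "\<lambda>_. nr" "T * nc", OF this]
  show ?thesis by (simp add: block_toeplitz_def sum_list_const_nat)
qed

lemma block_toeplitz_scalar_prod:
  assumes G: "\<And>d. d < T \<Longrightarrow> G d \<in> carrier_mat nr nc"
    and x: "\<And>l. l < T \<Longrightarrow> x l \<in> carrier_vec nc" and y: "\<And>j. j < T \<Longrightarrow> y j \<in> carrier_vec nr"
  shows "vstack (map y [0..<T]) \<bullet> (block_toeplitz T nr nc G *\<^sub>v vstack (map x [0..<T]))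
    = (\<Sum>j<T. \<Sum>l\<le>j. y j \<bullet> (G (j - l) *\<^sub>v x l))"
proof -
  define B where "B j l = (if l \<le> j then G (j - l) else 0\<^sub>m nr nc)" for j l
  have B: "B j l \<in> carrier_mat nr nc" if "j < T" for j l
    using G that by (auto simp: B_def)
  define H where "H j = hcat nr (map (B j) [0..<T])" for j
  have H: "H j \<in> carrier_mat nr (T * nc)" if "j < T" for j
    using hcat_carrier[of "[0..<T]" "B j" nr "\<lambda>_. nc"] B that by (auto simp: H_def sum_list_const_nat)
  have X: "vstack (map x [0..<T]) \<in> carrier_vec (T * nc)"
    using vstack_carrier[of "[0..<T]" x "\<lambda>_. nc"] x by (auto simp: sum_list_const_nat)
  have "block_toeplitz T nr nc G = vcat (T * nc) (map H [0..<T])"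
    unfolding block_toeplitz_def H_def B_def ..
  then have "block_toeplitz T nr nc G *\<^sub>v vstack (map x [0..<T]) = vstack (map (\<lambda>j. H j *\<^sub>v vstack (map x [0..<T])) [0..<T])"
    using vcat_mult_vec[of "[0..<T]" H "\<lambda>_. nr" "T * nc"] H X by simp
  then have "vstack (map y [0..<T]) \<bullet> (block_toeplitz T nr nc G *\<^sub>v vstack (map x [0..<T])) =
     (\<Sum>j\<leftarrow>[0..<T]. y j \<bullet> (H j *\<^sub>v vstack (map x [0..<T])))"
    by (simp only:) (rule vstack_scalar_prod[where d = "\<lambda>_. nr"], use y H X in \<open>auto intro!: mult_mat_vec_carrier\<close>)
  also have "\<dots> = (\<Sum>j<T. y j \<bullet> (H j *\<^sub>v vstack (map x [0..<T])))"
    by (simp add: sum_list_map_upt atLeast0LessThan)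
  also have "\<dots> = (\<Sum>j<T. \<Sum>l<T. y j \<bullet> (B j l *\<^sub>v x l))"
    unfolding H_def
    by (intro sum.cong refl, subst hcat_scalar_prod[where d = "\<lambda>_. nc"])
      (use x y B in \<open>auto simp: sum_list_map_upt atLeast0LessThan\<close>)
  also have "\<dots> = (\<Sum>j<T. \<Sum>l\<le>j. y j \<bullet> (G (j - l) *\<^sub>v x l))"
  proof (rule sum.cong[OF refl])
    fix j assume j: "j \<in> {..<T}"
    have "(\<Sum>l<T. y j \<bullet> (B j l *\<^sub>v x l)) = (\<Sum>l\<le>j. y j \<bullet> (B j l *\<^sub>v x l))"
      by (rule sum.mono_neutral_right) (use j x y in \<open>auto simp: B_def zero_mat_mult_vector\<close>)
    then show "(\<Sum>l<T. y j \<bullet> (B j l *\<^sub>v x l)) = (\<Sum>l\<le>j. y j \<bullet> (G (j - l) *\<^sub>v x l))"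
      by (simp add: B_def)
  qed
  finally show ?thesis .
qed

section \<open>Output of a linear system over a finite horizon\<close>

text \<open>Powers of a matrix are defined by multiplication on the right, whereas the recursion of a state
  space system multiplies on the left.\<close>

lemma pow_mat_Suc_left:
  "A \<in> carrier_mat n n \<Longrightarrow> A ^\<^sub>m Suc k = A * A ^\<^sub>m k" for A :: "real mat"
proof (induction k)
  case (Suc k)
  have "A ^\<^sub>m Suc (Suc k) = (A * A ^\<^sub>m k) * A"
    using Suc by simp
  also have "\<dots> = A * A ^\<^sub>m Suc k"
    using Suc.prems by (simp add: assoc_mult_mat[of _ n n _ n _ n])
  finally show ?case .
qed simp

lemma noise_mat_carrier:
  assumes "A \<in> carrier_mat n n" "C \<in> carrier_mat r n"
  shows "noise_mat T r n A C \<in> carrier_mat (T * r) (T * n)"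
  unfolding noise_mat_def by (rule block_toeplitz_carrier) (use assms in auto)

lemma input_mat_carrier:
  assumes "A \<in> carrier_mat n n" "C \<in> carrier_mat r n" "B \<in> carrier_mat n m"
  shows "input_mat T r m A C B \<in> carrier_mat (T * r) (T * m)"
  unfolding input_mat_def
  by (rule block_toeplitz_carrier) (use assms in \<open>auto intro!: mult_carrier_mat\<close>)

lemma obs_mat_carrier:
  assumes "A \<in> carrier_mat n n" "C \<in> carrier_mat r n"
  shows "obs_mat T n A C \<in> carrier_mat (T * r) n"
  using vcat_carrier[of "[1..<T+1]" "\<lambda>j. C * A ^\<^sub>m j" "\<lambda>_. r" n] assms
  by (auto simp: obs_mat_def sum_list_const_nat simp del: upt_Suc)

lemma vstack_upt_carrier:
  assumes "\<And>k. m \<le> k \<Longrightarrow> k < n \<Longrightarrow> f k \<in> carrier_vec d"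
  shows "vstack (map f [m..<n]) \<in> carrier_vec ((n - m) * d)"
  using vstack_carrier[of "[m..<n]" f "\<lambda>_. d"] assms by (auto simp: sum_list_const_nat)

lemma vstack_upt_exhaust:
  assumes "b \<in> carrier_vec (T * d)"
  obtains f where "\<And>k. k < T \<Longrightarrow> f k \<in> carrier_vec d" "b = vstack (map f [0..<T])"
  using vstack_exhaust[of b "\<lambda>_. d" "[0..<T]"] assms by (auto simp: sum_list_const_nat)

lemma vstack_upt_Suc: "vstack (map f [1..<T+1]) = vstack (map (\<lambda>k. f (Suc k)) [0..<T])"
proof -
  have "map f [1..<T+1] = map (\<lambda>k. f (Suc k)) [0..<T]"
    by (simp add: map_Suc_upt[symmetric] o_def del: upt_Suc)
  then show ?thesis by simp
qed

lemma vstack_upt_scalar_prod: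
  fixes f g :: "nat \<Rightarrow> real vec"
  assumes "\<And>k. k < T \<Longrightarrow> f k \<in> carrier_vec d" "\<And>k. k < T \<Longrightarrow> g k \<in> carrier_vec d"
  shows "vstack (map f [0..<T]) \<bullet> vstack (map g [0..<T]) = (\<Sum>k<T. f k \<bullet> g k)"
  using vstack_scalar_prod[of "[0..<T]" f "\<lambda>_. d" g] assms
  by (simp add: sum_list_map_upt atLeast0LessThan)

text \<open>An input entering through \<open>B\<close> acts on the outputs exactly as the process noise \<open>B u\<close> would. All
  inputs (interconnection, attack, noise) can therefore be propagated by \<open>noise_mat\<close> alone.\<close>

lemma noise_mat_input:
  assumes A: "A \<in> carrier_mat n n" and C: "C \<in> carrier_mat r n" and B: "B \<in> carrier_mat n m"
    and u: "\<And>k. k < T \<Longrightarrow> u k \<in> carrier_vec m"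
  shows "noise_mat T r n A C *\<^sub>v vstack (map (\<lambda>k. B *\<^sub>v u k) [0..<T]) = input_mat T r m A C B *\<^sub>v vstack (map u [0..<T])"
proof (rule vec_eqI_scalar_prod)
  fix a :: "real vec" assume "a \<in> carrier_vec (T * r)"
  then obtain y where y: "\<And>j. j < T \<Longrightarrow> y j \<in> carrier_vec r" and a: "a = vstack (map y [0..<T])"
    by (rule vstack_upt_exhaust) blast
  have Bu: "B *\<^sub>v u k \<in> carrier_vec n" if "k < T" for k using B u[OF that] by simp
  have CA: "C * A ^\<^sub>m d \<in> carrier_mat r n" "C * A ^\<^sub>m d * B \<in> carrier_mat r m" for d
    using A B C by (auto intro!: mult_carrier_mat)
  show "a \<bullet> (noise_mat T r n A C *\<^sub>v vstack (map (\<lambda>k. B *\<^sub>v u k) [0..<T])) = a \<bullet> (input_mat T r m A C B *\<^sub>v vstack (map u [0..<T]))"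
    unfolding a noise_mat_def input_mat_def
    using y u CA
    by (auto simp: block_toeplitz_scalar_prod Bu assoc_mult_mat_vec[OF CA(1) B] intro!: sum.cong)
qed (use assms in \<open>auto intro!: mult_mat_vec_carrier noise_mat_carrier input_mat_carrier vstack_upt_carrier[where m = 0, simplified]\<close>)

lemma state_response_scalar_prod:
  fixes A :: "real mat"
  assumes A: "A \<in> carrier_mat n n" and x0: "x 0 \<in> carrier_vec n" and e: "\<And>k. e k \<in> carrier_vec n"
    and x: "\<And>k. x (Suc k) = A *\<^sub>v x k + e k"
  shows "x k \<in> carrier_vec n"
    and "y \<in> carrier_vec n \<Longrightarrow> y \<bullet> x k = y \<bullet> (A ^\<^sub>m k *\<^sub>v x 0) + (\<Sum>l<k. y \<bullet> (A ^\<^sub>m (k - 1 - l) *\<^sub>v e l))"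
proof -
  show xk: "x k \<in> carrier_vec n" for k
    using A x0 e by (induction k) (auto simp: x intro!: add_carrier_vec mult_mat_vec_carrier)
  have pow: "A ^\<^sub>m j \<in> carrier_mat n n" for j using A by simp
  show "y \<in> carrier_vec n \<Longrightarrow> y \<bullet> x k = y \<bullet> (A ^\<^sub>m k *\<^sub>v x 0) + (\<Sum>l<k. y \<bullet> (A ^\<^sub>m (k - 1 - l) *\<^sub>v e l))"
  proof (induction k arbitrary: y)
    case 0
    then show ?case using A x0 by simp
  next
    case (Suc k)
    let ?z = "transpose_mat A *\<^sub>v y"
    have z: "?z \<in> carrier_vec n" using A Suc.prems by simp
    have shift: "?z \<bullet> (A ^\<^sub>m j *\<^sub>v v) = y \<bullet> (A ^\<^sub>m Suc j *\<^sub>v v)" if "v \<in> carrier_vec n" for j v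
    proof -
      have "y \<bullet> (A ^\<^sub>m Suc j *\<^sub>v v) = y \<bullet> (A *\<^sub>v (A ^\<^sub>m j *\<^sub>v v))"
        using A pow[of j] that by (simp only: pow_mat_Suc_left[OF A] assoc_mult_mat_vec)
      then show ?thesis
        using mult_mat_vec_scalar_prod_shift[OF A mult_mat_vec_carrier[OF pow that] Suc.prems] by simp
    qed
    have "y \<bullet> x (Suc k) = ?z \<bullet> x k + y \<bullet> e k"
      using A xk e Suc.prems
      by (simp add: x scalar_prod_add_distrib[of _ n] mult_mat_vec_scalar_prod_shift[OF A])
    also have "?z \<bullet> x k = y \<bullet> (A ^\<^sub>m Suc k *\<^sub>v x 0) + (\<Sum>l<k. y \<bullet> (A ^\<^sub>m Suc (k - 1 - l) *\<^sub>v e l))"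
      unfolding Suc.IH[OF z] shift[OF x0] shift[OF e] ..
    also have "(\<Sum>l<k. y \<bullet> (A ^\<^sub>m Suc (k - 1 - l) *\<^sub>v e l)) = (\<Sum>l<k. y \<bullet> (A ^\<^sub>m (Suc k - 1 - l) *\<^sub>v e l))"
      by (intro sum.cong refl) (simp del: pow_mat.simps add: Suc_diff_Suc)
    also have "y \<bullet> e k = y \<bullet> (A ^\<^sub>m (Suc k - 1 - k) *\<^sub>v e k)"
      using A e by simp
    finally show ?case by simp
  qed
qed

text \<open>The variation of constants formula, evaluated at the times \<open>1, \<dots>, T\<close>.\<close>

lemma output_decomposition:
  fixes A :: "real mat"
  assumes A: "A \<in> carrier_mat n n" and C: "C \<in> carrier_mat r n" and x0: "x 0 \<in> carrier_vec n"
    and e: "\<And>k. e k \<in> carrier_vec n" and v: "\<And>k. v k \<in> carrier_vec r"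
    and x: "\<And>k. x (Suc k) = A *\<^sub>v x k + e k"
  shows "vstack (map (\<lambda>k. C *\<^sub>v x k + v k) [1..<T+1])
    = obs_mat T n A C *\<^sub>v x 0 + noise_mat T r n A C *\<^sub>v vstack (map e [0..<T]) + vstack (map (\<lambda>k. v (Suc k)) [0..<T])"
proof (rule vec_eqI_scalar_prod)
  note xk = state_response_scalar_prod(1)[OF A x0 e x]
  note xy = state_response_scalar_prod(2)[OF A x0 e x]
  have Cx: "C *\<^sub>v x k \<in> carrier_vec r" for k using C xk by simp
  have pow: "A ^\<^sub>m j \<in> carrier_mat n n" for j using A by simp
  have CA: "C * A ^\<^sub>m d \<in> carrier_mat r n" for d using C pow by simp
  have E: "vstack (map e [0..<T]) \<in> carrier_vec (T * n)" and V: "vstack (map (\<lambda>k. v (Suc k)) [0..<T]) \<in> carrier_vec (T * r)"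
    using e v by (auto intro!: vstack_upt_carrier[where m = 0, simplified])
  have O: "obs_mat T n A C *\<^sub>v x 0 \<in> carrier_vec (T * r)"
    and N: "noise_mat T r n A C *\<^sub>v vstack (map e [0..<T]) \<in> carrier_vec (T * r)"
    using obs_mat_carrier[OF A C] noise_mat_carrier[OF A C] x0 E by (auto intro!: mult_mat_vec_carrier)
  then show "obs_mat T n A C *\<^sub>v x 0 + noise_mat T r n A C *\<^sub>v vstack (map e [0..<T]) + vstack (map (\<lambda>k. v (Suc k)) [0..<T]) \<in> carrier_vec (T * r)"
    using V by simp
  show "vstack (map (\<lambda>k. C *\<^sub>v x k + v k) [1..<T+1]) \<in> carrier_vec (T * r)"
    using vstack_upt_carrier[of 1 "T+1" "\<lambda>k. C *\<^sub>v x k + v k" r] Cx v by (simp del: upt_Suc)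
  fix a :: "real vec" assume a': "a \<in> carrier_vec (T * r)"
  then obtain y where y: "\<And>j. j < T \<Longrightarrow> y j \<in> carrier_vec r" and a: "a = vstack (map y [0..<T])"
    by (rule vstack_upt_exhaust) blast
  have yC: "y j \<bullet> (C *\<^sub>v (A ^\<^sub>m d *\<^sub>v z)) = y j \<bullet> ((C * A ^\<^sub>m d) *\<^sub>v z)" if "z \<in> carrier_vec n" for j d z
    using C pow that by (simp add: assoc_mult_mat_vec[of _ r n _ n])
  have Cy: "y j \<bullet> (C *\<^sub>v x (Suc j)) = y j \<bullet> ((C * A ^\<^sub>m Suc j) *\<^sub>v x 0) + (\<Sum>l\<le>j. y j \<bullet> ((C * A ^\<^sub>m (j - l)) *\<^sub>v e l))" if "j < T" for j
  proof -
    let ?z = "transpose_mat C *\<^sub>v y j"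
    have z: "?z \<in> carrier_vec n" using C y[OF that] by simp
    have shift: "?z \<bullet> q = y j \<bullet> (C *\<^sub>v q)" if "q \<in> carrier_vec n" for q
      using mult_mat_vec_scalar_prod_shift[OF C that y[OF \<open>j < T\<close>]] by simp
    have "y j \<bullet> (C *\<^sub>v x (Suc j)) = ?z \<bullet> x (Suc j)" using shift xk by simp
    also have "\<dots> = ?z \<bullet> (A ^\<^sub>m Suc j *\<^sub>v x 0) + (\<Sum>l<Suc j. ?z \<bullet> (A ^\<^sub>m (Suc j - 1 - l) *\<^sub>v e l))"
      by (rule xy[OF z])
    also have "\<dots> = y j \<bullet> (C *\<^sub>v (A ^\<^sub>m Suc j *\<^sub>v x 0)) + (\<Sum>l<Suc j. y j \<bullet> (C *\<^sub>v (A ^\<^sub>m (Suc j - 1 - l) *\<^sub>v e l)))"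
      using shift mult_mat_vec_carrier[OF pow x0] mult_mat_vec_carrier[OF pow e] by presburger
    finally show ?thesis
      unfolding yC[OF x0] yC[OF e] by (simp del: pow_mat.simps add: lessThan_Suc_atMost)
  qed
  have "a \<bullet> vstack (map (\<lambda>k. C *\<^sub>v x k + v k) [1..<T+1]) = (\<Sum>j<T. y j \<bullet> (C *\<^sub>v x (Suc j) + v (Suc j)))"
    unfolding a vstack_upt_Suc by (rule vstack_upt_scalar_prod) (use y Cx v in auto)
  also have "\<dots> = (\<Sum>j<T. y j \<bullet> (C *\<^sub>v x (Suc j)) + y j \<bullet> v (Suc j))"
    using y Cx v by (intro sum.cong refl scalar_prod_add_distrib) auto
  also have "\<dots> = (\<Sum>j<T. y j \<bullet> ((C * A ^\<^sub>m Suc j) *\<^sub>v x 0)) + (\<Sum>j<T. \<Sum>l\<le>j. y j \<bullet> ((C * A ^\<^sub>m (j - l)) *\<^sub>v e l)) + (\<Sum>j<T. y j \<bullet> v (Suc j))"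
    using Cy by (simp add: sum.distrib)
  also have "(\<Sum>j<T. \<Sum>l\<le>j. y j \<bullet> ((C * A ^\<^sub>m (j - l)) *\<^sub>v e l)) = a \<bullet> (noise_mat T r n A C *\<^sub>v vstack (map e [0..<T]))"
    unfolding a noise_mat_def by (subst block_toeplitz_scalar_prod) (use CA e y in auto)
  also have "(\<Sum>j<T. y j \<bullet> v (Suc j)) = a \<bullet> vstack (map (\<lambda>k. v (Suc k)) [0..<T])"
    unfolding a by (rule vstack_upt_scalar_prod[symmetric]) (use y v in auto)
  also have "(\<Sum>j<T. y j \<bullet> ((C * A ^\<^sub>m Suc j) *\<^sub>v x 0)) = a \<bullet> (obs_mat T n A C *\<^sub>v x 0)"
  proof -
    have "obs_mat T n A C *\<^sub>v x 0 = vstack (map (\<lambda>j. (C * A ^\<^sub>m Suc j) *\<^sub>v x 0) [0..<T])"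
      unfolding obs_mat_def by (subst vcat_mult_vec[where d = "\<lambda>_. r"], rule CA, rule x0, rule vstack_upt_Suc)
    then show ?thesis
      unfolding a using vstack_upt_scalar_prod[of T y r "\<lambda>j. (C * A ^\<^sub>m Suc j) *\<^sub>v x 0"] y CA x0
      by (metis mult_mat_vec_carrier)
  qed
  finally show "a \<bullet> vstack (map (\<lambda>k. C *\<^sub>v x k + v k) [1..<T+1]) = a \<bullet> (obs_mat T n A C *\<^sub>v x 0 + noise_mat T r n A C *\<^sub>v vstack (map e [0..<T]) + vstack (map (\<lambda>k. v (Suc k)) [0..<T]))"
    using O N V a' by (simp add: scalar_prod_add_distrib[of _ "T * r"])
qed

lemma mat_congruence:
  fixes R K :: "real mat"
  assumes R: "R \<in> carrier_mat p m" and K: "K \<in> carrier_mat m m"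
  shows "R * K * transpose_mat R \<in> carrier_mat p p"
    and "a \<in> carrier_vec p \<Longrightarrow> (R * K * transpose_mat R) *\<^sub>v a = R *\<^sub>v (K *\<^sub>v (transpose_mat R *\<^sub>v a))"
    and "transpose_mat K = K \<Longrightarrow> transpose_mat (R * K * transpose_mat R) = R * K * transpose_mat R"
proof -
  have RK: "R * K \<in> carrier_mat p m" and tR: "transpose_mat R \<in> carrier_mat m p" using R K by auto
  show "R * K * transpose_mat R \<in> carrier_mat p p" using RK tR by simp
  show "(R * K * transpose_mat R) *\<^sub>v a = R *\<^sub>v (K *\<^sub>v (transpose_mat R *\<^sub>v a))" if "a \<in> carrier_vec p"
    using assoc_mult_mat_vec[OF RK tR that] assoc_mult_mat_vec[OF R K mult_mat_vec_carrier[OF tR that]] by (simp only:)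
  assume tK: "transpose_mat K = K"
  have "transpose_mat (R * K * transpose_mat R) = R * (K * transpose_mat R)"
    using transpose_mult[OF RK tR] transpose_mult[OF R K] by (simp add: tK)
  also have "\<dots> = R * K * transpose_mat R"
    using assoc_mult_mat[OF R K tR] by simp
  finally show "transpose_mat (R * K * transpose_mat R) = R * K * transpose_mat R" .
qed

text \<open>The weights \<open>c\<close> and \<open>d\<close> are the blocks of \<open>F\<^sup>T R\<^sup>T a\<close> and of \<open>R\<^sup>T a\<close>, where \<open>F\<close> is the noise
  matrix. The same weights split the quadratic form of the residual covariance into those of the
  single noise vectors; this is what connects \<open>resid_cov\<close> with exponential moments.\<close>

lemma resid_functional:
  assumes A: "A \<in> carrier_mat n n" and C: "C \<in> carrier_mat r n" and R: "R \<in> carrier_mat p (T * r)"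
    and Sw: "Sw \<in> carrier_mat n n" and Sv: "Sv \<in> carrier_mat r r" and a: "a \<in> carrier_vec p"
  obtains c d where "\<And>k. k < T \<Longrightarrow> c k \<in> carrier_vec n" "\<And>k. k < T \<Longrightarrow> d k \<in> carrier_vec r"
    "\<And>W V. (\<And>k. k < T \<Longrightarrow> W k \<in> carrier_vec n) \<Longrightarrow> (\<And>k. k < T \<Longrightarrow> V k \<in> carrier_vec r) \<Longrightarrow>
      a \<bullet> (R *\<^sub>v (noise_mat T r n A C *\<^sub>v vstack (map W [0..<T]) + vstack (map V [0..<T])))
      = (\<Sum>k<T. c k \<bullet> W k) + (\<Sum>k<T. d k \<bullet> V k)"
    "a \<bullet> (resid_cov T n r A C Sw Sv R *\<^sub>v a) = (\<Sum>k<T. c k \<bullet> (Sw *\<^sub>v c k)) + (\<Sum>k<T. d k \<bullet> (Sv *\<^sub>v d k))"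
proof -
  define F where "F = noise_mat T r n A C"
  have F: "F \<in> carrier_mat (T * r) (T * n)" unfolding F_def by (rule noise_mat_carrier[OF A C])
  define b where "b = transpose_mat R *\<^sub>v a"
  have b: "b \<in> carrier_vec (T * r)" unfolding b_def using R a by simp
  define g where "g = transpose_mat F *\<^sub>v b"
  have g: "g \<in> carrier_vec (T * n)" unfolding g_def using F b by simp
  obtain d where d: "\<And>k. k < T \<Longrightarrow> d k \<in> carrier_vec r" and bd: "b = vstack (map d [0..<T])"
    using b by (rule vstack_upt_exhaust) blast
  obtain c where c: "\<And>k. k < T \<Longrightarrow> c k \<in> carrier_vec n" and gc: "g = vstack (map c [0..<T])"
    using g by (rule vstack_upt_exhaust) blast
  have Dw: "repeat_diag T Sw \<in> carrier_mat (T * n) (T * n)" and Dv: "repeat_diag T Sv \<in> carrier_mat (T * r) (T * r)"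
    using diag_block_mat_carrier[of "[0..<T]" "\<lambda>_. Sw" "\<lambda>_. n" "\<lambda>_. n"] Sw
      diag_block_mat_carrier[of "[0..<T]" "\<lambda>_. Sv" "\<lambda>_. r" "\<lambda>_. r"] Sv
    by (auto simp: repeat_diag_eq sum_list_const_nat)
  have 1: "a \<bullet> (R *\<^sub>v (F *\<^sub>v vstack (map W [0..<T]) + vstack (map V [0..<T]))) = (\<Sum>k<T. c k \<bullet> W k) + (\<Sum>k<T. d k \<bullet> V k)"
    if W: "\<And>k. k < T \<Longrightarrow> W k \<in> carrier_vec n" and V: "\<And>k. k < T \<Longrightarrow> V k \<in> carrier_vec r" for W V
  proof -
    have WV: "vstack (map W [0..<T]) \<in> carrier_vec (T * n)" "vstack (map V [0..<T]) \<in> carrier_vec (T * r)"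
      using W V by (auto intro!: vstack_upt_carrier[where m = 0, simplified])
    have FW: "F *\<^sub>v vstack (map W [0..<T]) \<in> carrier_vec (T * r)" using F WV by simp
    have "a \<bullet> (R *\<^sub>v (F *\<^sub>v vstack (map W [0..<T]) + vstack (map V [0..<T]))) = b \<bullet> (F *\<^sub>v vstack (map W [0..<T]) + vstack (map V [0..<T]))"
      unfolding b_def by (rule mult_mat_vec_scalar_prod_shift[OF R]) (use FW WV a in auto)
    also have "\<dots> = g \<bullet> vstack (map W [0..<T]) + b \<bullet> vstack (map V [0..<T])"
      unfolding g_def using FW WV b by (simp add: scalar_prod_add_distrib[of _ "T * r"] mult_mat_vec_scalar_prod_shift[OF F])
    also have "g \<bullet> vstack (map W [0..<T]) = (\<Sum>k<T. c k \<bullet> W k)"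
      unfolding gc by (rule vstack_upt_scalar_prod) (use c W in auto)
    also have "b \<bullet> vstack (map V [0..<T]) = (\<Sum>k<T. d k \<bullet> V k)"
      unfolding bd by (rule vstack_upt_scalar_prod) (use d V in auto)
    finally show ?thesis .
  qed
  define K where "K = F * repeat_diag T Sw * transpose_mat F + repeat_diag T Sv"
  note FDF = mat_congruence[OF F Dw]
  have K: "K \<in> carrier_mat (T * r) (T * r)" unfolding K_def using FDF(1) Dv by simp
  have Kb: "K *\<^sub>v b = F *\<^sub>v (repeat_diag T Sw *\<^sub>v g) + repeat_diag T Sv *\<^sub>v b"
    unfolding K_def g_def add_mult_distrib_mat_vec[OF FDF(1) Dv b] FDF(2)[OF b] ..
  have "a \<bullet> (resid_cov T n r A C Sw Sv R *\<^sub>v a) = a \<bullet> (R *\<^sub>v (K *\<^sub>v b))"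
    unfolding resid_cov_def Let_def F_def[symmetric] K_def[symmetric] b_def
    by (simp only: mat_congruence(2)[OF R K a])
  also have "\<dots> = b \<bullet> (K *\<^sub>v b)"
    unfolding b_def by (rule mult_mat_vec_scalar_prod_shift[OF R]) (use K R a in auto)
  also have "\<dots> = b \<bullet> (F *\<^sub>v (repeat_diag T Sw *\<^sub>v g)) + b \<bullet> (repeat_diag T Sv *\<^sub>v b)"
    unfolding Kb by (rule scalar_prod_add_distrib[of _ "T * r"]) (use F Dw Dv b g in \<open>auto intro!: mult_mat_vec_carrier\<close>)
  also have "b \<bullet> (F *\<^sub>v (repeat_diag T Sw *\<^sub>v g)) = g \<bullet> (repeat_diag T Sw *\<^sub>v g)"
    unfolding g_def by (rule mult_mat_vec_scalar_prod_shift[OF F]) (use F Dw b in \<open>auto intro!: mult_mat_vec_carrier\<close>)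
  also have "\<dots> = (\<Sum>k<T. c k \<bullet> (Sw *\<^sub>v c k))"
    unfolding gc repeat_diag_eq
    by (subst diag_block_mat_quad[where d = "\<lambda>_. n"]) (use c Sw in \<open>auto simp: sum_list_map_upt atLeast0LessThan\<close>)
  also have "b \<bullet> (repeat_diag T Sv *\<^sub>v b) = (\<Sum>k<T. d k \<bullet> (Sv *\<^sub>v d k))"
    unfolding bd repeat_diag_eq
    by (subst diag_block_mat_quad[where d = "\<lambda>_. r"]) (use d Sv in \<open>auto simp: sum_list_map_upt atLeast0LessThan\<close>)
  finally have 2: "a \<bullet> (resid_cov T n r A C Sw Sv R *\<^sub>v a) = (\<Sum>k<T. c k \<bullet> (Sw *\<^sub>v c k)) + (\<Sum>k<T. d k \<bullet> (Sv *\<^sub>v d k))" .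
  show thesis
    by (rule that[of c d]) (use c d 2 1[unfolded F_def] in auto)
qed

lemma resid_cov_symmetric:
  assumes A: "A \<in> carrier_mat n n" and C: "C \<in> carrier_mat r n" and R: "R \<in> carrier_mat p (T * r)"
    and Sw: "Sw \<in> carrier_mat n n" "transpose_mat Sw = Sw" and Sv: "Sv \<in> carrier_mat r r" "transpose_mat Sv = Sv"
  shows "resid_cov T n r A C Sw Sv R \<in> carrier_mat p p"
    and "transpose_mat (resid_cov T n r A C Sw Sv R) = resid_cov T n r A C Sw Sv R"
proof -
  define F where "F = noise_mat T r n A C"
  have F: "F \<in> carrier_mat (T * r) (T * n)" unfolding F_def by (rule noise_mat_carrier[OF A C])
  have Dw: "repeat_diag T Sw \<in> carrier_mat (T * n) (T * n)" and Dv: "repeat_diag T Sv \<in> carrier_mat (T * r) (T * r)"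
    using diag_block_mat_carrier[of "[0..<T]" "\<lambda>_. Sw" "\<lambda>_. n" "\<lambda>_. n"] Sw
      diag_block_mat_carrier[of "[0..<T]" "\<lambda>_. Sv" "\<lambda>_. r" "\<lambda>_. r"] Sv
    by (auto simp: repeat_diag_eq sum_list_const_nat)
  have tD: "transpose_mat (repeat_diag T Sw) = repeat_diag T Sw" "transpose_mat (repeat_diag T Sv) = repeat_diag T Sv"
    using Sw Sv by (simp_all add: repeat_diag_def transpose_diag_block_mat)
  define K where "K = F * repeat_diag T Sw * transpose_mat F + repeat_diag T Sv"
  note FDF = mat_congruence[OF F Dw]
  have K: "K \<in> carrier_mat (T * r) (T * r)" unfolding K_def using FDF(1) Dv by simp
  have "transpose_mat K = K"
    unfolding K_def transpose_add[OF FDF(1) Dv] FDF(3)[OF tD(1)] tD(2) ..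
  then show "transpose_mat (resid_cov T n r A C Sw Sv R) = resid_cov T n r A C Sw Sv R"
    unfolding resid_cov_def Let_def F_def[symmetric] K_def[symmetric] by (rule mat_congruence(3)[OF R K])
  show "resid_cov T n r A C Sw Sv R \<in> carrier_mat p p"
    unfolding resid_cov_def Let_def F_def[symmetric] K_def[symmetric] by (rule mat_congruence(1)[OF R K])
qed

section \<open>Filtered outputs as affine functions of the noise\<close>

lemma left_null_basis_annihilates:
  assumes "left_null_basis R K"
  shows "R \<in> carrier_mat (dim_row R) (dim_row K)"
    and "z \<in> carrier_vec (dim_col K) \<Longrightarrow> R *\<^sub>v (K *\<^sub>v z) = 0\<^sub>v (dim_row R)"
proof -
  let ?m = "dim_row K"
  interpret kernel "dim_col K" ?m "transpose_mat K" by unfold_locales auto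
  from assms have R: "dim_col R = ?m" and "Ker.basis (set (rows R))"
    by (auto simp: left_null_basis_def)
  then have ker: "set (rows R) \<subseteq> mat_kernel (transpose_mat K)"
    unfolding Ker.basis_def by auto
  show RK: "R \<in> carrier_mat (dim_row R) ?m" using R by auto
  show "R *\<^sub>v (K *\<^sub>v z) = 0\<^sub>v (dim_row R)" if z: "z \<in> carrier_vec (dim_col K)"
  proof (rule eq_vecI)
    fix i assume "i < dim_vec (0\<^sub>v (dim_row R) :: real vec)"
    then have i: "i < dim_row R" by simp
    then have "row R i \<in> mat_kernel (transpose_mat K)"
      using ker by (auto simp: rows_def)
    then have "row R i \<in> carrier_vec ?m" "transpose_mat K *\<^sub>v row R i = 0\<^sub>v (dim_col K)"
      by (auto simp: mat_kernel_def)
    then have "row R i \<bullet> (K *\<^sub>v z) = 0"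
      using mult_mat_vec_scalar_prod_shift[of K ?m "dim_col K" z "row R i"] z by auto
    then show "(R *\<^sub>v (K *\<^sub>v z)) $ i = 0\<^sub>v (dim_row R) $ i"
      using i by simp
  qed simp
qed

text \<open>Without rows in the filter the statistic would be constantly zero. Nontriviality of the null
  space gives it at least one degree of freedom.\<close>

lemma left_null_basis_nonempty:
  assumes "left_null_basis R K" "left_null_nontrivial K"
  shows "dim_row R > 0"
proof (rule ccontr)
  let ?m = "dim_row K"
  interpret kernel "dim_col K" ?m "transpose_mat K" by unfold_locales auto
  assume "\<not> dim_row R > 0"
  then have "set (rows R) = {}" by (simp add: rows_def)
  with assms(1) have "Ker.gen_set {}"
    by (simp add: left_null_basis_def Ker.basis_def)
  then have "mat_kernel (transpose_mat K) = {0\<^sub>v ?m}"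
    by (simp add: Ker.span_empty)
  with assms(2) show False by (simp add: left_null_nontrivial_def)
qed

lemma hcat_pair_mult_vec:
  assumes M: "M1 \<in> carrier_mat n d1" "M2 \<in> carrier_mat n d2" and x: "x1 \<in> carrier_vec d1" "x2 \<in> carrier_vec d2"
  shows "hcat n [M1, M2] \<in> carrier_mat n (d1 + d2)"
    and "vstack [x1, x2] \<in> carrier_vec (d1 + d2)"
    and "hcat n [M1, M2] *\<^sub>v vstack [x1, x2] = M1 *\<^sub>v x1 + M2 *\<^sub>v x2"
proof -
  define ks where "ks = [(M1, x1, d1), (M2, x2, d2)]"
  have p: "fst k \<in> carrier_mat n (snd (snd k))" "fst (snd k) \<in> carrier_vec (snd (snd k))" if "k \<in> set ks" for k
    using that M x by (auto simp: ks_def)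
  have ks: "map fst ks = [M1, M2]" "map (\<lambda>k. fst (snd k)) ks = [x1, x2]" "(\<Sum>k\<leftarrow>ks. snd (snd k)) = d1 + d2"
    by (simp_all add: ks_def)
  show H: "hcat n [M1, M2] \<in> carrier_mat n (d1 + d2)"
    using hcat_carrier[of ks fst n "\<lambda>k. snd (snd k)"] p(1) unfolding ks by blast
  show X: "vstack [x1, x2] \<in> carrier_vec (d1 + d2)"
    using vstack_carrier[of ks "\<lambda>k. fst (snd k)" "\<lambda>k. snd (snd k)"] p(2) unfolding ks by blast
  show "hcat n [M1, M2] *\<^sub>v vstack [x1, x2] = M1 *\<^sub>v x1 + M2 *\<^sub>v x2"
  proof (rule vec_eqI_scalar_prod)
    fix a :: "real vec" assume a: "a \<in> carrier_vec n"
    have "a \<bullet> (hcat n (map fst ks) *\<^sub>v vstack (map (\<lambda>k. fst (snd k)) ks)) = (\<Sum>k\<leftarrow>ks. a \<bullet> (fst k *\<^sub>v fst (snd k)))"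
      by (rule hcat_scalar_prod[where d = "\<lambda>k. snd (snd k)"]) (use p a in auto)
    then have "a \<bullet> (hcat n [M1, M2] *\<^sub>v vstack [x1, x2]) = a \<bullet> (M1 *\<^sub>v x1) + a \<bullet> (M2 *\<^sub>v x2)"
      unfolding ks by (simp add: ks_def del: vstack_simps)
    then show "a \<bullet> (hcat n [M1, M2] *\<^sub>v vstack [x1, x2]) = a \<bullet> (M1 *\<^sub>v x1 + M2 *\<^sub>v x2)"
      using scalar_prod_add_distrib[OF a, of "M1 *\<^sub>v x1" "M2 *\<^sub>v x2"] M x by simp
  qed (use mult_mat_vec_carrier[OF H X] M x in auto)
qed

text \<open>All noise vectors of the plant are indexed together: \<open>Inl (i, k)\<close> is the process noise and
  \<open>Inr (i, k)\<close> the measurement noise of subsystem \<open>i\<close> at time \<open>k\<close>.\<close>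

definition noise_dim :: "plant \<Rightarrow> (nat \<times> nat) + (nat \<times> nat) \<Rightarrow> nat" where
  "noise_dim P = case_sum (\<lambda>(i, k). xdim P i) (\<lambda>(i, k). ydim P i)"

definition noise_cov :: "plant \<Rightarrow> (nat \<times> nat) + (nat \<times> nat) \<Rightarrow> real mat" where
  "noise_cov P = case_sum (\<lambda>(i, k). Wcov P i) (\<lambda>(i, k). Vcov P i)"

definition noise_vec :: "'w noise \<Rightarrow> 'w noise \<Rightarrow> (nat \<times> nat) + (nat \<times> nat) \<Rightarrow> 'w \<Rightarrow> real vec" where
  "noise_vec w v = case_sum (\<lambda>(i, k). w i k) (\<lambda>(i, k). v i k)"

text \<open>The noises of the subsystems in \<open>I\<close> that influence the outputs at times \<open>1, \<dots>, T\<close>: process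
  noise acts with a delay of one step.\<close>

definition noise_ix :: "nat set \<Rightarrow> nat \<Rightarrow> ((nat \<times> nat) + (nat \<times> nat)) set" where
  "noise_ix I T = (I \<times> {..<T}) <+> (I \<times> Suc ` {..<T})"

lemma finite_noise_ix [simp]: "finite I \<Longrightarrow> finite (noise_ix I T)"
  by (simp add: noise_ix_def)

lemma sum_noise_ix:
  assumes "finite I"
  shows "(\<Sum>s\<in>noise_ix I T. f s) = (\<Sum>k<T. \<Sum>i\<in>I. f (Inl (i, k))) + (\<Sum>k<T. \<Sum>i\<in>I. f (Inr (i, Suc k)))"
proof -
  have "(\<Sum>s\<in>noise_ix I T. f s) = (\<Sum>i\<in>I. \<Sum>k<T. f (Inl (i, k))) + (\<Sum>i\<in>I. \<Sum>k\<in>Suc ` {..<T}. f (Inr (i, k)))"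
    using assms by (simp add: noise_ix_def sum.Plus sum.cartesian_product o_def)
  also have "(\<Sum>i\<in>I. \<Sum>k\<in>Suc ` {..<T}. f (Inr (i, k))) = (\<Sum>i\<in>I. \<Sum>k<T. f (Inr (i, Suc k)))"
    by (simp add: sum.reindex)
  finally show ?thesis by (simp add: sum.swap[of _ I])
qed

text \<open>This predicate collects what the detectors see of a filtered output \<open>r\<close>: it is affine in the noises
  of the index set \<open>J\<close>, and \<open>S\<close> is the covariance that independent noises would give it. Local and
  centralized detectors are treated alike from here on; they differ in the index set only. The
  last clause is stated for one functional \<open>a\<close> at a time, as laws of linear functionals are all
  that is used.\<close>

definition noise_residual ::
  "plant \<Rightarrow> 'w noise \<Rightarrow> 'w noise \<Rightarrow> 'w set \<Rightarrow> ((nat \<times> nat) + (nat \<times> nat)) set \<Rightarrow> nat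
    \<Rightarrow> ('w \<Rightarrow> real vec) \<Rightarrow> real vec \<Rightarrow> real mat \<Rightarrow> bool" where
  "noise_residual P w v \<Omega> J n r \<beta> S \<longleftrightarrow>
     \<beta> \<in> carrier_vec n \<and> S \<in> carrier_mat n n \<and> transpose_mat S = S \<and> (\<forall>\<omega>\<in>\<Omega>. r \<omega> \<in> carrier_vec n) \<and>
     (\<forall>a\<in>carrier_vec n. \<exists>c. (\<forall>s\<in>J. c s \<in> carrier_vec (noise_dim P s)) \<and>
        (\<forall>\<omega>\<in>\<Omega>. a \<bullet> r \<omega> = a \<bullet> \<beta> + (\<Sum>s\<in>J. c s \<bullet> noise_vec w v s \<omega>)) \<and>
        a \<bullet> (S *\<^sub>v a) = (\<Sum>s\<in>J. c s \<bullet> (noise_cov P s *\<^sub>v c s)))"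

locale attacked_plant =
  fixes M :: "'w measure" and P :: plant and w v :: "'w noise" and ua :: attack
  assumes plant: "plant_dims P" and noise: "noise_model M P w v" and attack: "attack_dims P ua"
begin

lemma dims:
  assumes "i < nsub P"
  shows "j < nsub P \<Longrightarrow> Amat P i j \<in> carrier_mat (xdim P i) (xdim P j)"
    "Bmat P i \<in> carrier_mat (xdim P i) (adim P i)" "Cmat P i \<in> carrier_mat (ydim P i) (xdim P i)"
    "Wcov P i \<in> carrier_mat (xdim P i) (xdim P i)" "Vcov P i \<in> carrier_mat (ydim P i) (ydim P i)"
    "xini P i \<in> carrier_vec (xdim P i)" "ua i k \<in> carrier_vec (adim P i)"
    "transpose_mat (Wcov P i) = Wcov P i" "transpose_mat (Vcov P i) = Vcov P i"
    "\<omega> \<in> space M \<Longrightarrow> w i k \<omega> \<in> carrier_vec (xdim P i)" "\<omega> \<in> space M \<Longrightarrow> v i k \<omega> \<in> carrier_vec (ydim P i)"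
  using assms plant attack noise
  by (auto simp: plant_dims_def attack_dims_def noise_model_def gaussian_vec_def)

lemma set_others: "set (others P i) = {..<nsub P} - {i}"
  by (auto simp: others_def)

lemma Bint_carrier: "i < nsub P \<Longrightarrow> Bint P i \<in> carrier_mat (xdim P i) (sum_list (map (xdim P) (others P i)))"
  unfolding Bint_def by (rule hcat_carrier) (use dims(1) set_others in auto)

lemma state_carrier: "\<omega> \<in> space M \<Longrightarrow> i < nsub P \<Longrightarrow> state P ua w k i \<omega> \<in> carrier_vec (xdim P i)"
proof (induction k arbitrary: i)
  case (Suc k)
  have "vstack (map (\<lambda>j. state P ua w k j \<omega>) (others P i)) \<in> carrier_vec (sum_list (map (xdim P) (others P i)))"
    by (rule vstack_carrier) (use Suc set_others in auto)
  with Suc show ?case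
    using dims[OF Suc.prems(2)] Bint_carrier[OF Suc.prems(2)] Suc.IH[OF Suc.prems]
    by (auto intro!: add_carrier_vec mult_mat_vec_carrier)
qed (use dims in auto)

text \<open>The interconnection signal is treated as an unknown input: it is produced by the noises of the other
  subsystems as well, but the filter annihilates its contribution along with that of the initial
  state. This is why only the noises of subsystem \<open>i\<close> remain.\<close>

lemma local_residual:
  assumes i: "i < nsub P" and R: "left_null_basis R (loc_mat P T i)"
  shows "noise_residual P w v (space M) (noise_ix {i} T) (dim_row R)
    (\<lambda>\<omega>. R *\<^sub>v vstack (map (\<lambda>k. meas P ua w v i k \<omega>) [1..<T+1]))
    (R *\<^sub>v (input_mat T (ydim P i) (adim P i) (Amat P i i) (Cmat P i) (Bmat P i) *\<^sub>v vstack (map (ua i) [0..<T])))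
    (loc_cov P T i R)"
proof -
  let ?n = "xdim P i" and ?r = "ydim P i" and ?A = "Amat P i i" and ?C = "Cmat P i"
  define p where "p = dim_row R"
  let ?m = "sum_list (map (xdim P) (others P i))"
  note D = dims[OF i]
  note A = D(1)[OF i] and C = D(3) and B = Bint_carrier[OF i]
  let ?F = "noise_mat T ?r ?n ?A ?C"
  note O = obs_mat_carrier[OF A C, of T] and F = noise_mat_carrier[OF A C, of T]
  note FB = input_mat_carrier[OF A C B, of T] and FA = input_mat_carrier[OF A C D(2), of T]
  have Kdim: "loc_mat P T i \<in> carrier_mat (T * ?r) (?n + T * ?m)"
    unfolding loc_mat_def by (rule hcat_pair_mult_vec(1)[OF O FB zero_carrier_vec zero_carrier_vec])
  have R': "R \<in> carrier_mat p (T * ?r)"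
    using left_null_basis_annihilates(1)[OF R] unfolding carrier_matD(1)[OF Kdim] p_def .
  let ?ua = "vstack (map (ua i) [0..<T])"
  have UA: "?ua \<in> carrier_vec (T * adim P i)"
    by (rule vstack_upt_carrier[where m = 0, simplified]) (rule D(7))
  have bb: "input_mat T ?r (adim P i) ?A ?C (Bmat P i) *\<^sub>v ?ua \<in> carrier_vec (T * ?r)"
    by (rule mult_mat_vec_carrier[OF FA UA])
  let ?b = "R *\<^sub>v (input_mat T ?r (adim P i) ?A ?C (Bmat P i) *\<^sub>v ?ua)"
  have b: "?b \<in> carrier_vec p" by (rule mult_mat_vec_carrier[OF R' bb])
  note S = resid_cov_symmetric[OF A C R' D(4,8) D(5,9)]
  let ?y = "\<lambda>\<omega>. vstack (map (\<lambda>k. meas P ua w v i k \<omega>) [1..<T+1])"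
  let ?noise = "\<lambda>\<omega>. ?F *\<^sub>v vstack (map (\<lambda>k. w i k \<omega>) [0..<T]) + vstack (map (\<lambda>k. v i (Suc k) \<omega>) [0..<T])"
  have res: "R *\<^sub>v ?y \<omega> = ?b + R *\<^sub>v ?noise \<omega>" and noise_carrier: "?noise \<omega> \<in> carrier_vec (T * ?r)" if \<omega>: "\<omega> \<in> space M" for \<omega>
  proof -
    define x where "x k = state P ua w k i \<omega>" for k
    define u where "u k = vstack (map (\<lambda>j. state P ua w k j \<omega>) (others P i))" for k
    have x: "x k \<in> carrier_vec ?n" for k unfolding x_def by (rule state_carrier[OF \<omega> i])
    have u: "u k \<in> carrier_vec ?m" for k
      unfolding u_def by (rule vstack_carrier, rule state_carrier[OF \<omega>]) (simp add: set_others)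
    note W = D(10)[OF \<omega>] and V = D(11)[OF \<omega>]
    have Bu: "Bint P i *\<^sub>v u k \<in> carrier_vec ?n" for k using B u by simp
    have Ba: "Bmat P i *\<^sub>v ua i k \<in> carrier_vec ?n" for k using D(2,7) by simp
    have step: "x (Suc k) = ?A *\<^sub>v x k + (Bint P i *\<^sub>v u k + (Bmat P i *\<^sub>v ua i k + w i k \<omega>))" for k
    proof -
      have "?A *\<^sub>v x k \<in> carrier_vec ?n" using A x by simp
      then show ?thesis
        using Bu[of k] Ba[of k] W[of k] by (simp add: x_def u_def assoc_add_vec[of _ ?n])
    qed
    let ?BU = "vstack (map (\<lambda>k. Bint P i *\<^sub>v u k) [0..<T])" and ?BA = "vstack (map (\<lambda>k. Bmat P i *\<^sub>v ua i k) [0..<T])"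
      and ?W = "vstack (map (\<lambda>k. w i k \<omega>) [0..<T])" and ?V = "vstack (map (\<lambda>k. v i (Suc k) \<omega>) [0..<T])"
    have c: "?BU \<in> carrier_vec (T * ?n)" "?BA \<in> carrier_vec (T * ?n)" "?W \<in> carrier_vec (T * ?n)" "?V \<in> carrier_vec (T * ?r)"
      using Bu Ba W V by (auto intro!: vstack_upt_carrier[where m = 0, simplified])
    have "vstack (map (\<lambda>k. Bint P i *\<^sub>v u k + (Bmat P i *\<^sub>v ua i k + w i k \<omega>)) [0..<T]) = ?BU + (?BA + ?W)"
      using Bu Ba W by (simp add: vstack_add[where d = "\<lambda>_. ?n"])
    moreover have "?y \<omega> = vstack (map (\<lambda>k. ?C *\<^sub>v x k + v i k \<omega>) [1..<T+1])"
      by (simp add: meas_def x_def)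
    ultimately have "?y \<omega> = obs_mat T ?n ?A ?C *\<^sub>v x 0 + ?F *\<^sub>v (?BU + (?BA + ?W)) + ?V"
      using output_decomposition[where x = x and e = "\<lambda>k. Bint P i *\<^sub>v u k + (Bmat P i *\<^sub>v ua i k + w i k \<omega>)" and v = "\<lambda>k. v i k \<omega>" and T = T, OF A C x] Bu Ba W V step
      by (simp del: upt_Suc)
    also have "?F *\<^sub>v (?BU + (?BA + ?W)) = ?F *\<^sub>v ?BU + (?F *\<^sub>v ?BA + ?F *\<^sub>v ?W)"
      using F c by (simp add: mult_add_distrib_mat_vec[of _ "T * ?r" "T * ?n"])
    also have "?F *\<^sub>v ?BU = input_mat T ?r ?m ?A ?C (Bint P i) *\<^sub>v vstack (map u [0..<T])"
      by (rule noise_mat_input[OF A C B u])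
    also have "?F *\<^sub>v ?BA = input_mat T ?r (adim P i) ?A ?C (Bmat P i) *\<^sub>v ?ua"
      by (rule noise_mat_input[OF A C D(2) D(7)])
    finally have y: "?y \<omega> = obs_mat T ?n ?A ?C *\<^sub>v x 0 + (input_mat T ?r ?m ?A ?C (Bint P i) *\<^sub>v vstack (map u [0..<T]) +
      (input_mat T ?r (adim P i) ?A ?C (Bmat P i) *\<^sub>v ?ua + ?F *\<^sub>v ?W)) + ?V" .
    have U: "vstack (map u [0..<T]) \<in> carrier_vec (T * ?m)"
      using u by (auto intro!: vstack_upt_carrier[where m = 0, simplified])
    \<comment> \<open>the unknown part of the output lies in the range of the matrix that the filter annihilates\<close>
    define z where "z = vstack [x 0, vstack (map u [0..<T])]"
    have z: "z \<in> carrier_vec (?n + T * ?m)"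
      and Kz: "loc_mat P T i *\<^sub>v z = obs_mat T ?n ?A ?C *\<^sub>v x 0 + input_mat T ?r ?m ?A ?C (Bint P i) *\<^sub>v vstack (map u [0..<T])"
      unfolding loc_mat_def z_def using hcat_pair_mult_vec(2,3)[OF O FB x[of 0] U] by (auto simp del: vstack_simps)
    have cc: "obs_mat T ?n ?A ?C *\<^sub>v x 0 \<in> carrier_vec (T * ?r)"
      "input_mat T ?r ?m ?A ?C (Bint P i) *\<^sub>v vstack (map u [0..<T]) \<in> carrier_vec (T * ?r)"
      "?F *\<^sub>v ?W \<in> carrier_vec (T * ?r)"
      using O FB F U c x by (auto intro!: mult_mat_vec_carrier)
    show n: "?noise \<omega> \<in> carrier_vec (T * ?r)" using cc c by simp
    have "?y \<omega> = loc_mat P T i *\<^sub>v z + (input_mat T ?r (adim P i) ?A ?C (Bmat P i) *\<^sub>v ?ua + ?noise \<omega>)"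
      unfolding y Kz using cc c bb by (simp add: assoc_add_vec[of _ "T * ?r"])
    moreover have "R *\<^sub>v (loc_mat P T i *\<^sub>v z) = 0\<^sub>v p"
      unfolding p_def by (rule left_null_basis_annihilates(2)[OF R]) (use z in \<open>simp only: carrier_matD(2)[OF Kdim]\<close>)
    moreover have "loc_mat P T i *\<^sub>v z \<in> carrier_vec (T * ?r)" using Kdim z by simp
    ultimately show "R *\<^sub>v ?y \<omega> = ?b + R *\<^sub>v ?noise \<omega>"
      using R' bb n b
      by (simp only: mult_add_distrib_mat_vec[OF R'] add_carrier_vec) (simp add: left_zero_vec[of _ p])
  qed
  have fun_repr: "\<exists>c. (\<forall>s\<in>noise_ix {i} T. c s \<in> carrier_vec (noise_dim P s)) \<and>
        (\<forall>\<omega>\<in>space M. a \<bullet> (R *\<^sub>v ?y \<omega>) = a \<bullet> ?b + (\<Sum>s\<in>noise_ix {i} T. c s \<bullet> noise_vec w v s \<omega>)) \<and>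
        a \<bullet> (loc_cov P T i R *\<^sub>v a) = (\<Sum>s\<in>noise_ix {i} T. c s \<bullet> (noise_cov P s *\<^sub>v c s))"
    if a: "a \<in> carrier_vec p" for a
  proof -
    obtain c d where c: "\<And>k. k < T \<Longrightarrow> c k \<in> carrier_vec ?n" and d: "\<And>k. k < T \<Longrightarrow> d k \<in> carrier_vec ?r"
      and WV: "\<And>W V. (\<And>k. k < T \<Longrightarrow> W k \<in> carrier_vec ?n) \<Longrightarrow> (\<And>k. k < T \<Longrightarrow> V k \<in> carrier_vec ?r) \<Longrightarrow>
        a \<bullet> (R *\<^sub>v (?F *\<^sub>v vstack (map W [0..<T]) + vstack (map V [0..<T]))) = (\<Sum>k<T. c k \<bullet> W k) + (\<Sum>k<T. d k \<bullet> V k)"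
      and q: "a \<bullet> (loc_cov P T i R *\<^sub>v a) = (\<Sum>k<T. c k \<bullet> (Wcov P i *\<^sub>v c k)) + (\<Sum>k<T. d k \<bullet> (Vcov P i *\<^sub>v d k))"
      unfolding loc_cov_def by (rule resid_functional[OF A C R' D(4,5) a]) blast
    define c' where "c' = case_sum (\<lambda>(j::nat, k). c k) (\<lambda>(j::nat, k). d (k - 1))"
    show ?thesis
    proof (intro exI[of _ c'] conjI ballI)
      show "c' s \<in> carrier_vec (noise_dim P s)" if "s \<in> noise_ix {i} T" for s
        using that c d by (auto simp: noise_ix_def c'_def noise_dim_def)
      show "a \<bullet> (R *\<^sub>v ?y \<omega>) = a \<bullet> ?b + (\<Sum>s\<in>noise_ix {i} T. c' s \<bullet> noise_vec w v s \<omega>)" if \<omega>: "\<omega> \<in> space M" for \<omega>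
      proof -
        have "a \<bullet> (R *\<^sub>v ?y \<omega>) = a \<bullet> ?b + a \<bullet> (R *\<^sub>v ?noise \<omega>)"
          unfolding res[OF \<omega>] by (rule scalar_prod_add_distrib[OF a b]) (rule mult_mat_vec_carrier[OF R' noise_carrier[OF \<omega>]])
        then show ?thesis
          using WV[of "\<lambda>k. w i k \<omega>" "\<lambda>k. v i (Suc k) \<omega>"] D(10,11)[OF \<omega>]
          by (simp add: sum_noise_ix c'_def noise_vec_def)
      qed
      show "a \<bullet> (loc_cov P T i R *\<^sub>v a) = (\<Sum>s\<in>noise_ix {i} T. c' s \<bullet> (noise_cov P s *\<^sub>v c' s))"
        by (simp add: q sum_noise_ix c'_def noise_cov_def)
    qed
  qed
  have "R *\<^sub>v ?y \<omega> \<in> carrier_vec p" if "\<omega> \<in> space M" for \<omega>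
    unfolding res[OF that] by (rule add_carrier_vec[OF b mult_mat_vec_carrier[OF R' noise_carrier[OF that]]])
  then show ?thesis
    unfolding noise_residual_def p_def[symmetric] using b fun_repr S unfolding loc_cov_def by blast
qed

lemma sum_list_subsystems: "(\<Sum>i\<leftarrow>[0..<nsub P]. f i) = (\<Sum>i<nsub P. f i)"
  for f :: "nat \<Rightarrow> 'b::comm_monoid_add"
  by (simp add: sum_list_map_upt atLeast0LessThan)

lemma stack_subsystems_carrier:
  assumes "\<And>i. i < nsub P \<Longrightarrow> f i \<in> carrier_vec (d i)"
  shows "vstack (map f [0..<nsub P]) \<in> carrier_vec (\<Sum>i<nsub P. d i)"
  using vstack_carrier[of "[0..<nsub P]" f d] assms by (simp add: sum_list_subsystems)

lemma blkdiag_carrier: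
  assumes "\<And>i. i < nsub P \<Longrightarrow> D i \<in> carrier_mat (r i) (c i)"
  shows "blkdiag P D \<in> carrier_mat (\<Sum>i<nsub P. r i) (\<Sum>i<nsub P. c i)"
  using diag_block_mat_carrier[of "[0..<nsub P]" D r c] assms by (simp add: blkdiag_def sum_list_subsystems)

lemma blkdiag_mult_vec:
  assumes "\<And>i. i < nsub P \<Longrightarrow> D i \<in> carrier_mat (r i) (c i)" "\<And>i. i < nsub P \<Longrightarrow> x i \<in> carrier_vec (c i)"
  shows "blkdiag P D *\<^sub>v vstack (map x [0..<nsub P]) = vstack (map (\<lambda>i. D i *\<^sub>v x i) [0..<nsub P])"
  unfolding blkdiag_def by (rule diag_block_mat_mult_vec[where r = r and c = c]) (use assms in auto)

lemma blkdiag_transpose: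
  assumes "\<And>i. i < nsub P \<Longrightarrow> transpose_mat (D i) = D i"
  shows "transpose_mat (blkdiag P D) = blkdiag P D"
  using assms by (auto simp: blkdiag_def transpose_diag_block_mat intro!: arg_cong[of _ _ diag_block_mat])

lemma blkdiag_quad:
  assumes "\<And>i. i < nsub P \<Longrightarrow> D i \<in> carrier_mat (d i) (d i)" "\<And>i. i < nsub P \<Longrightarrow> x i \<in> carrier_vec (d i)"
  shows "vstack (map x [0..<nsub P]) \<bullet> (blkdiag P D *\<^sub>v vstack (map x [0..<nsub P])) = (\<Sum>i<nsub P. x i \<bullet> (D i *\<^sub>v x i))"
  unfolding blkdiag_def
  by (subst diag_block_mat_quad[where d = d]) (use assms in \<open>auto simp: sum_list_subsystems\<close>)

lemma stack_subsystems_scalar_prod: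
  fixes f g :: "nat \<Rightarrow> real vec"
  assumes "\<And>i. i < nsub P \<Longrightarrow> f i \<in> carrier_vec (d i)" "\<And>i. i < nsub P \<Longrightarrow> g i \<in> carrier_vec (d i)"
  shows "vstack (map f [0..<nsub P]) \<bullet> vstack (map g [0..<nsub P]) = (\<Sum>i<nsub P. f i \<bullet> g i)"
  using vstack_scalar_prod[of "[0..<nsub P]" f d g] assms by (simp add: sum_list_subsystems)

lemma Aall_carrier: "Aall P \<in> carrier_mat (xsum P) (xsum P)"
proof -
  have "hcat (xdim P i) (map (Amat P i) [0..<nsub P]) \<in> carrier_mat (xdim P i) (xsum P)" if "i < nsub P" for i
    using hcat_carrier[of "[0..<nsub P]" "Amat P i" "xdim P i" "xdim P"] dims(1)[OF that]
    by (simp add: sum_list_subsystems xsum_def)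
  then show ?thesis
    using vcat_carrier[of "[0..<nsub P]" "\<lambda>i. hcat (xdim P i) (map (Amat P i) [0..<nsub P])" "xdim P" "xsum P"]
    by (simp add: Aall_def sum_list_subsystems) (simp add: xsum_def)
qed

text \<open>Separating the diagonal block from the rest of its block row recovers the recursion of the single
  subsystems, so that the stacked plant is again a linear system of the form treated above.\<close>

lemma Aall_mult_vec:
  assumes x: "\<And>i. i < nsub P \<Longrightarrow> x i \<in> carrier_vec (xdim P i)"
  shows "Aall P *\<^sub>v vstack (map x [0..<nsub P])
    = vstack (map (\<lambda>i. Amat P i i *\<^sub>v x i + Bint P i *\<^sub>v vstack (map x (others P i))) [0..<nsub P])"
proof -
  let ?X = "vstack (map x [0..<nsub P])"
  let ?H = "\<lambda>i. hcat (xdim P i) (map (Amat P i) [0..<nsub P])"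
  have X: "?X \<in> carrier_vec (xsum P)" unfolding xsum_def by (rule stack_subsystems_carrier) (rule x)
  have H: "?H i \<in> carrier_mat (xdim P i) (xsum P)" if "i < nsub P" for i
    using hcat_carrier[of "[0..<nsub P]" "Amat P i" "xdim P i" "xdim P"] dims(1)[OF that]
    by (simp add: sum_list_subsystems xsum_def)
  have row: "?H i *\<^sub>v ?X = Amat P i i *\<^sub>v x i + Bint P i *\<^sub>v vstack (map x (others P i))" if i: "i < nsub P" for i
  proof (rule vec_eqI_scalar_prod)
    have o: "vstack (map x (others P i)) \<in> carrier_vec (sum_list (map (xdim P) (others P i)))"
      by (rule vstack_carrier) (use x set_others in auto)
    note Bo = mult_mat_vec_carrier[OF Bint_carrier[OF i] o]
    have Ax: "Amat P i i *\<^sub>v x i \<in> carrier_vec (xdim P i)" using dims(1)[OF i i] x[OF i] by simp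
    then show "Amat P i i *\<^sub>v x i + Bint P i *\<^sub>v vstack (map x (others P i)) \<in> carrier_vec (xdim P i)"
      using Bo by simp
    show "?H i *\<^sub>v ?X \<in> carrier_vec (xdim P i)" using H[OF i] X by simp
    fix a :: "real vec" assume a: "a \<in> carrier_vec (xdim P i)"
    have "a \<bullet> (Bint P i *\<^sub>v vstack (map x (others P i))) = (\<Sum>j\<leftarrow>others P i. a \<bullet> (Amat P i j *\<^sub>v x j))"
      unfolding Bint_def by (rule hcat_scalar_prod[where d = "xdim P"]) (use dims(1)[OF i] set_others x a in auto)
    also have "\<dots> = (\<Sum>j\<in>{..<nsub P} - {i}. a \<bullet> (Amat P i j *\<^sub>v x j))"
      by (subst sum_list_distinct_conv_sum_set) (simp add: others_def, simp add: set_others)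
    finally have "a \<bullet> (Amat P i i *\<^sub>v x i) + a \<bullet> (Bint P i *\<^sub>v vstack (map x (others P i))) = (\<Sum>j<nsub P. a \<bullet> (Amat P i j *\<^sub>v x j))"
      using i by (simp add: sum.remove[of "{..<nsub P}" i])
    also have "\<dots> = a \<bullet> (?H i *\<^sub>v ?X)"
      by (subst hcat_scalar_prod[where d = "xdim P"]) (use dims(1)[OF i] x a in \<open>auto simp: sum_list_subsystems\<close>)
    finally show "a \<bullet> (?H i *\<^sub>v ?X) = a \<bullet> (Amat P i i *\<^sub>v x i + Bint P i *\<^sub>v vstack (map x (others P i)))"
      by (simp add: scalar_prod_add_distrib[OF a Ax Bo])
  qed
  have "Aall P *\<^sub>v ?X = vstack (map (\<lambda>i. ?H i *\<^sub>v ?X) [0..<nsub P])"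
    unfolding Aall_def by (rule vcat_mult_vec[where d = "xdim P"]) (use H X in auto)
  also have "\<dots> = vstack (map (\<lambda>i. Amat P i i *\<^sub>v x i + Bint P i *\<^sub>v vstack (map x (others P i))) [0..<nsub P])"
    using row by (intro arg_cong[of _ _ vstack] map_cong) auto
  finally show ?thesis .
qed

text \<open>The stacked states obey one linear recursion. Compared with the local case the interconnection
  is part of the system matrix, and the stacked noises have to be taken apart again into the noises
  of the subsystems.\<close>

lemma central_residual:
  assumes R: "left_null_basis R (cen_mat P T)"
  shows "noise_residual P w v (space M) (noise_ix {..<nsub P} T) (dim_row R)
    (\<lambda>\<omega>. R *\<^sub>v vstack (map (\<lambda>k. vstack (map (\<lambda>i. meas P ua w v i k \<omega>) [0..<nsub P])) [1..<T+1]))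
    (cen_mean P T ua R) (cen_cov P T R)"
proof -
  let ?N = "nsub P" and ?n = "xsum P" and ?r = "ysum P" and ?A = "Aall P" and ?C = "blkdiag P (Cmat P)"
  define p where "p = dim_row R"
  let ?B = "blkdiag P (Bmat P)" and ?F = "noise_mat T (ysum P) (xsum P) (Aall P) (blkdiag P (Cmat P))"
  note A = Aall_carrier
  have C: "?C \<in> carrier_mat ?r ?n" and B: "?B \<in> carrier_mat ?n (asum P)"
    and Sw: "blkdiag P (Wcov P) \<in> carrier_mat ?n ?n" and Sv: "blkdiag P (Vcov P) \<in> carrier_mat ?r ?r"
    unfolding xsum_def ysum_def asum_def by (rule blkdiag_carrier, rule dims, assumption)+
  have tSw: "transpose_mat (blkdiag P (Wcov P)) = blkdiag P (Wcov P)"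
    and tSv: "transpose_mat (blkdiag P (Vcov P)) = blkdiag P (Vcov P)"
    by (rule blkdiag_transpose, rule dims, assumption)+
  note O = obs_mat_carrier[OF A C, of T] and F = noise_mat_carrier[OF A C, of T]
  note FA = input_mat_carrier[OF A C B, of T]
  have R': "R \<in> carrier_mat p (T * ?r)"
    using left_null_basis_annihilates(1)[OF R] unfolding cen_mat_def carrier_matD(1)[OF O] p_def .
  define U where "U k = vstack (map (\<lambda>i. ua i k) [0..<?N])" for k
  have U: "U k \<in> carrier_vec (asum P)" for k
    unfolding U_def asum_def by (rule stack_subsystems_carrier) (rule dims)
  let ?ua = "vstack (map U [0..<T])"
  have UA: "?ua \<in> carrier_vec (T * asum P)"
    by (rule vstack_upt_carrier[where m = 0, simplified]) (rule U)
  have bb: "input_mat T ?r (asum P) ?A ?C ?B *\<^sub>v ?ua \<in> carrier_vec (T * ?r)"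
    by (rule mult_mat_vec_carrier[OF FA UA])
  have b_eq: "cen_mean P T ua R = R *\<^sub>v (input_mat T ?r (asum P) ?A ?C ?B *\<^sub>v ?ua)"
    by (simp add: cen_mean_def U_def[abs_def])
  have b: "cen_mean P T ua R \<in> carrier_vec p" unfolding b_eq by (rule mult_mat_vec_carrier[OF R' bb])
  note S = resid_cov_symmetric[OF A C R' Sw tSw Sv tSv]
  let ?y = "\<lambda>\<omega>. vstack (map (\<lambda>k. vstack (map (\<lambda>i. meas P ua w v i k \<omega>) [0..<?N])) [1..<T+1])"
  define W where "W k \<omega> = vstack (map (\<lambda>i. w i k \<omega>) [0..<?N])" for k \<omega>
  define V where "V k \<omega> = vstack (map (\<lambda>i. v i k \<omega>) [0..<?N])" for k \<omega>
  have W: "W k \<omega> \<in> carrier_vec ?n" and V: "V k \<omega> \<in> carrier_vec ?r" if "\<omega> \<in> space M" for k \<omega>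
    unfolding W_def V_def xsum_def ysum_def by (rule stack_subsystems_carrier, rule dims, assumption, rule that)+
  let ?noise = "\<lambda>\<omega>. ?F *\<^sub>v vstack (map (\<lambda>k. W k \<omega>) [0..<T]) + vstack (map (\<lambda>k. V (Suc k) \<omega>) [0..<T])"
  have res: "R *\<^sub>v ?y \<omega> = cen_mean P T ua R + R *\<^sub>v ?noise \<omega>" and noise_carrier: "?noise \<omega> \<in> carrier_vec (T * ?r)" if \<omega>: "\<omega> \<in> space M" for \<omega>
  proof -
    note st = state_carrier[OF \<omega>]
    define x where "x k = vstack (map (\<lambda>i. state P ua w k i \<omega>) [0..<?N])" for k
    have x: "x k \<in> carrier_vec ?n" for k
      unfolding x_def xsum_def by (rule stack_subsystems_carrier) (rule st)
    have Ba: "?B *\<^sub>v U k \<in> carrier_vec ?n" for k using B U by simp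
    have step: "x (Suc k) = ?A *\<^sub>v x k + (?B *\<^sub>v U k + W k \<omega>)" for k
    proof -
      let ?f = "\<lambda>i. Amat P i i *\<^sub>v state P ua w k i \<omega> + Bint P i *\<^sub>v vstack (map (\<lambda>j. state P ua w k j \<omega>) (others P i))"
      have fc: "?f i \<in> carrier_vec (xdim P i)" if "i < ?N" for i
      proof -
        have "vstack (map (\<lambda>j. state P ua w k j \<omega>) (others P i)) \<in> carrier_vec (sum_list (map (xdim P) (others P i)))"
          by (rule vstack_carrier) (use st set_others in auto)
        then show ?thesis using Bint_carrier[OF that] dims(1)[OF that that] st[OF that] by simp
      qed
      have Bc: "Bmat P i *\<^sub>v ua i k \<in> carrier_vec (xdim P i)" if "i < ?N" for i
        using dims(2,7)[OF that] by simp
      have "x (Suc k) = vstack (map (\<lambda>i. ?f i + (Bmat P i *\<^sub>v ua i k + w i k \<omega>)) [0..<?N])"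
        unfolding x_def state.simps
      proof (intro arg_cong[of _ _ vstack] map_cong refl)
        fix i assume "i \<in> set [0..<?N]"
        then have i: "i < ?N" by simp
        show "?f i + Bmat P i *\<^sub>v ua i k + w i k \<omega> = ?f i + (Bmat P i *\<^sub>v ua i k + w i k \<omega>)"
          by (rule assoc_add_vec[OF fc[OF i] Bc[OF i] dims(10)[OF i \<omega>]])
      qed
      also have "\<dots> = vstack (map ?f [0..<?N]) + vstack (map (\<lambda>i. Bmat P i *\<^sub>v ua i k + w i k \<omega>) [0..<?N])"
        by (rule vstack_add[where d = "xdim P"]) (use fc Bc dims(10) \<omega> in auto)
      also have "vstack (map (\<lambda>i. Bmat P i *\<^sub>v ua i k + w i k \<omega>) [0..<?N]) = vstack (map (\<lambda>i. Bmat P i *\<^sub>v ua i k) [0..<?N]) + W k \<omega>"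
        unfolding W_def by (rule vstack_add[where d = "xdim P"]) (use Bc dims(10) \<omega> in auto)
      also have "vstack (map (\<lambda>i. Bmat P i *\<^sub>v ua i k) [0..<?N]) = ?B *\<^sub>v U k"
        unfolding U_def by (rule blkdiag_mult_vec[symmetric], erule dims, erule dims)
      also have "vstack (map ?f [0..<?N]) = ?A *\<^sub>v x k"
        unfolding x_def by (rule Aall_mult_vec[symmetric]) (rule st)
      finally show ?thesis .
    qed
    let ?BA = "vstack (map (\<lambda>k. ?B *\<^sub>v U k) [0..<T])"
      and ?W = "vstack (map (\<lambda>k. W k \<omega>) [0..<T])" and ?V = "vstack (map (\<lambda>k. V (Suc k) \<omega>) [0..<T])"
    have c: "?BA \<in> carrier_vec (T * ?n)" "?W \<in> carrier_vec (T * ?n)" "?V \<in> carrier_vec (T * ?r)"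
      using Ba W V \<omega> by (auto intro!: vstack_upt_carrier[where m = 0, simplified])
    have "vstack (map (\<lambda>k. ?B *\<^sub>v U k + W k \<omega>) [0..<T]) = ?BA + ?W"
      using Ba W \<omega> by (simp add: vstack_add[where d = "\<lambda>_. ?n"])
    moreover have "vstack (map (\<lambda>i. meas P ua w v i k \<omega>) [0..<?N]) = ?C *\<^sub>v x k + V k \<omega>" for k
    proof -
      have "vstack (map (\<lambda>i. meas P ua w v i k \<omega>) [0..<?N]) = vstack (map (\<lambda>i. Cmat P i *\<^sub>v state P ua w k i \<omega>) [0..<?N]) + V k \<omega>"
        unfolding meas_def V_def
      proof (rule vstack_add[where d = "ydim P"])
        fix i assume "i \<in> set [0..<?N]"
        then have i: "i < ?N" by simp
        show "Cmat P i *\<^sub>v state P ua w k i \<omega> \<in> carrier_vec (ydim P i)" using dims(3)[OF i] st[OF i] by simp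
        show "v i k \<omega> \<in> carrier_vec (ydim P i)" by (rule dims(11)[OF i \<omega>])
      qed
      then show ?thesis
        unfolding x_def by (subst blkdiag_mult_vec[where r = "ydim P" and c = "xdim P"]) (use dims(3) st in auto)
    qed
    ultimately have "?y \<omega> = obs_mat T ?n ?A ?C *\<^sub>v x 0 + ?F *\<^sub>v (?BA + ?W) + ?V"
      using output_decomposition[where x = x and e = "\<lambda>k. ?B *\<^sub>v U k + W k \<omega>" and v = "\<lambda>k. V k \<omega>" and T = T, OF A C x] Ba W V \<omega> step
      by (simp del: upt_Suc)
    also have "?F *\<^sub>v (?BA + ?W) = ?F *\<^sub>v ?BA + ?F *\<^sub>v ?W"
      using F c by (simp add: mult_add_distrib_mat_vec[of _ "T * ?r" "T * ?n"])
    also have "?F *\<^sub>v ?BA = input_mat T ?r (asum P) ?A ?C ?B *\<^sub>v ?ua"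
      by (rule noise_mat_input[OF A C B U])
    finally have y: "?y \<omega> = obs_mat T ?n ?A ?C *\<^sub>v x 0 + (input_mat T ?r (asum P) ?A ?C ?B *\<^sub>v ?ua + ?F *\<^sub>v ?W) + ?V" .
    have cc: "obs_mat T ?n ?A ?C *\<^sub>v x 0 \<in> carrier_vec (T * ?r)" "?F *\<^sub>v ?W \<in> carrier_vec (T * ?r)"
      using O F c x by (auto intro!: mult_mat_vec_carrier)
    show n: "?noise \<omega> \<in> carrier_vec (T * ?r)" using cc c by simp
    have "?y \<omega> = cen_mat P T *\<^sub>v x 0 + (input_mat T ?r (asum P) ?A ?C ?B *\<^sub>v ?ua + ?noise \<omega>)"
      unfolding y cen_mat_def using cc c bb by (simp add: assoc_add_vec[of _ "T * ?r"])
    moreover have "R *\<^sub>v (cen_mat P T *\<^sub>v x 0) = 0\<^sub>v p"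
      unfolding p_def by (rule left_null_basis_annihilates(2)[OF R]) (use x in \<open>simp only: cen_mat_def carrier_matD(2)[OF O]\<close>)
    moreover have "cen_mat P T *\<^sub>v x 0 \<in> carrier_vec (T * ?r)" using cc by (simp add: cen_mat_def)
    ultimately show "R *\<^sub>v ?y \<omega> = cen_mean P T ua R + R *\<^sub>v ?noise \<omega>"
      using R' bb n b unfolding b_eq
      by (simp only: mult_add_distrib_mat_vec[OF R'] add_carrier_vec) (simp add: left_zero_vec[of _ p])
  qed
  have fun_repr: "\<exists>c. (\<forall>s\<in>noise_ix {..<?N} T. c s \<in> carrier_vec (noise_dim P s)) \<and>
        (\<forall>\<omega>\<in>space M. a \<bullet> (R *\<^sub>v ?y \<omega>) = a \<bullet> cen_mean P T ua R + (\<Sum>s\<in>noise_ix {..<?N} T. c s \<bullet> noise_vec w v s \<omega>)) \<and>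
        a \<bullet> (cen_cov P T R *\<^sub>v a) = (\<Sum>s\<in>noise_ix {..<?N} T. c s \<bullet> (noise_cov P s *\<^sub>v c s))"
    if a: "a \<in> carrier_vec p" for a
  proof -
    obtain c d where c: "\<And>k. k < T \<Longrightarrow> c k \<in> carrier_vec ?n" and d: "\<And>k. k < T \<Longrightarrow> d k \<in> carrier_vec ?r"
      and WV: "\<And>W V. (\<And>k. k < T \<Longrightarrow> W k \<in> carrier_vec ?n) \<Longrightarrow> (\<And>k. k < T \<Longrightarrow> V k \<in> carrier_vec ?r) \<Longrightarrow>
        a \<bullet> (R *\<^sub>v (?F *\<^sub>v vstack (map W [0..<T]) + vstack (map V [0..<T]))) = (\<Sum>k<T. c k \<bullet> W k) + (\<Sum>k<T. d k \<bullet> V k)"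
      and q: "a \<bullet> (cen_cov P T R *\<^sub>v a) = (\<Sum>k<T. c k \<bullet> (blkdiag P (Wcov P) *\<^sub>v c k)) + (\<Sum>k<T. d k \<bullet> (blkdiag P (Vcov P) *\<^sub>v d k))"
      unfolding cen_cov_def by (rule resid_functional[OF A C R' Sw Sv a]) blast
    have split: "\<exists>f. (\<forall>i<?N. f i \<in> carrier_vec (dm i)) \<and> b = vstack (map f [0..<?N])"
      if "b \<in> carrier_vec (\<Sum>i<?N. dm i)" for b and dm :: "nat \<Rightarrow> nat"
    proof -
      have "b \<in> carrier_vec (\<Sum>i\<leftarrow>[0..<?N]. dm i)" using that by (simp add: sum_list_subsystems)
      then obtain f where "\<And>i. i \<in> set [0..<?N] \<Longrightarrow> f i \<in> carrier_vec (dm i)" "b = vstack (map f [0..<?N])"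
        using vstack_exhaust[OF _ distinct_upt] by blast
      then show ?thesis by auto
    qed
    have "\<forall>k\<in>{..<T}. \<exists>f. (\<forall>i<?N. f i \<in> carrier_vec (xdim P i)) \<and> c k = vstack (map f [0..<?N])"
      using split c by (simp add: xsum_def)
    then obtain cf where cf: "\<And>k i. k < T \<Longrightarrow> i < ?N \<Longrightarrow> cf k i \<in> carrier_vec (xdim P i)"
      "\<And>k. k < T \<Longrightarrow> c k = vstack (map (cf k) [0..<?N])"
      unfolding bchoice_iff by auto
    have "\<forall>k\<in>{..<T}. \<exists>f. (\<forall>i<?N. f i \<in> carrier_vec (ydim P i)) \<and> d k = vstack (map f [0..<?N])"
      using split d by (simp add: ysum_def)
    then obtain df where df: "\<And>k i. k < T \<Longrightarrow> i < ?N \<Longrightarrow> df k i \<in> carrier_vec (ydim P i)"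
      "\<And>k. k < T \<Longrightarrow> d k = vstack (map (df k) [0..<?N])"
      unfolding bchoice_iff by auto
    define c' where "c' = case_sum (\<lambda>(i, k). cf k i) (\<lambda>(i, k). df (k - 1) i)"
    show ?thesis
    proof (intro exI[of _ c'] conjI ballI)
      show "c' s \<in> carrier_vec (noise_dim P s)" if "s \<in> noise_ix {..<?N} T" for s
        using that cf df by (auto simp: noise_ix_def c'_def noise_dim_def)
      show "a \<bullet> (R *\<^sub>v ?y \<omega>) = a \<bullet> cen_mean P T ua R + (\<Sum>s\<in>noise_ix {..<?N} T. c' s \<bullet> noise_vec w v s \<omega>)" if \<omega>: "\<omega> \<in> space M" for \<omega>
      proof -
        have "a \<bullet> (R *\<^sub>v ?y \<omega>) = a \<bullet> cen_mean P T ua R + a \<bullet> (R *\<^sub>v ?noise \<omega>)"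
          unfolding res[OF \<omega>] by (rule scalar_prod_add_distrib[OF a b]) (rule mult_mat_vec_carrier[OF R' noise_carrier[OF \<omega>]])
        also have "a \<bullet> (R *\<^sub>v ?noise \<omega>) = (\<Sum>k<T. c k \<bullet> W k \<omega>) + (\<Sum>k<T. d k \<bullet> V (Suc k) \<omega>)"
          by (rule WV) (use W V \<omega> in auto)
        also have "(\<Sum>k<T. c k \<bullet> W k \<omega>) = (\<Sum>k<T. \<Sum>i<?N. cf k i \<bullet> w i k \<omega>)"
          using cf dims(10) \<omega> unfolding W_def
          by (intro sum.cong[OF refl]) (simp, rule stack_subsystems_scalar_prod[where d = "xdim P"], auto)
        also have "(\<Sum>k<T. d k \<bullet> V (Suc k) \<omega>) = (\<Sum>k<T. \<Sum>i<?N. df k i \<bullet> v i (Suc k) \<omega>)"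
          using df dims(11) \<omega> unfolding V_def
          by (intro sum.cong[OF refl]) (simp, rule stack_subsystems_scalar_prod[where d = "ydim P"], auto)
        finally show ?thesis
          by (simp add: sum_noise_ix c'_def noise_vec_def)
      qed
      have "(\<Sum>k<T. c k \<bullet> (blkdiag P (Wcov P) *\<^sub>v c k)) = (\<Sum>k<T. \<Sum>i<?N. cf k i \<bullet> (Wcov P i *\<^sub>v cf k i))"
        using cf dims(4)
        by (intro sum.cong[OF refl]) (simp, rule blkdiag_quad[where d = "xdim P"], auto)
      moreover have "(\<Sum>k<T. d k \<bullet> (blkdiag P (Vcov P) *\<^sub>v d k)) = (\<Sum>k<T. \<Sum>i<?N. df k i \<bullet> (Vcov P i *\<^sub>v df k i))"
        using df dims(5)
        by (intro sum.cong[OF refl]) (simp, rule blkdiag_quad[where d = "ydim P"], auto)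
      ultimately show "a \<bullet> (cen_cov P T R *\<^sub>v a) = (\<Sum>s\<in>noise_ix {..<?N} T. c' s \<bullet> (noise_cov P s *\<^sub>v c' s))"
        by (simp add: q sum_noise_ix c'_def noise_cov_def)
    qed
  qed
  have "R *\<^sub>v ?y \<omega> \<in> carrier_vec p" if "\<omega> \<in> space M" for \<omega>
    unfolding res[OF that] by (rule add_carrier_vec[OF b mult_mat_vec_carrier[OF R' noise_carrier[OF that]]])
  then show ?thesis
    unfolding noise_residual_def p_def[symmetric] using b fun_repr S unfolding cen_cov_def by blast
qed

end

section \<open>Orthonormal vectors for a positive definite form\<close>

lemma scalar_prod_self_pos:
  fixes v :: "real vec"
  assumes "v \<in> carrier_vec n" "v \<noteq> 0\<^sub>v n"
  shows "v \<bullet> v > 0"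
proof -
  obtain i where "i < n" "v $ i \<noteq> 0" using assms by (metis carrier_vecD eq_vecI index_zero_vec)
  then show ?thesis
    using assms(1) unfolding scalar_prod_def by (intro sum_pos2[of _ i]) (auto simp: zero_less_mult_iff)
qed

lemma invertible_mat_det:
  fixes S :: "real mat"
  assumes "S \<in> carrier_mat n n" "invertible_mat S"
  shows "det S \<noteq> 0"
proof -
  obtain B where B: "S * B = 1\<^sub>m (dim_row S)" "B * S = 1\<^sub>m (dim_row B)"
    using assms(2) by (auto simp: invertible_mat_def inverts_mat_def)
  have "dim_col B = n" using arg_cong[OF B(1), of dim_col] assms(1) by simp
  moreover have "dim_row B = n" using arg_cong[OF B(2), of dim_col] assms(1) by simp
  ultimately have "B \<in> carrier_mat n n" by auto
  from det_mult[OF assms(1) this] B(1) assms(1) show ?thesis by auto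
qed

lemma mat_inv_eq:
  assumes S: "S \<in> carrier_mat n n" and X: "X \<in> carrier_mat n n" and "S * X = 1\<^sub>m n"
  shows "mat_inv S = X"
proof -
  have XS: "X * S = 1\<^sub>m n" by (rule mat_mult_left_right_inverse[OF S X assms(3)])
  then have "S \<in> Units (ring_mat TYPE(real) n ())"
    using S X assms(3) by (auto simp: Units_def ring_mat_simps)
  then obtain B where B: "mat_inverse S = Some B"
    using mat_inverse(1)[OF S, where b = "()"] by (cases "mat_inverse S") auto
  note BS = mat_inverse(2)[OF S B]
  have "B = B * (S * X)" using BS assms(3) right_mult_one_mat[of B n n] by simp
  also have "\<dots> = (B * S) * X" by (rule assoc_mult_mat[symmetric]) (use BS S X in auto)
  also have "\<dots> = X" using BS X by simp
  finally show ?thesis using B by (simp add: mat_inv_def)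
qed

lemma exists_vec_combination:
  fixes q :: "nat \<Rightarrow> real vec"
  assumes "\<And>j. j < k \<Longrightarrow> q j \<in> carrier_vec n"
  shows "\<exists>a\<in>carrier_vec n. \<forall>y\<in>carrier_vec n. a \<bullet> y = (\<Sum>j<k. g j * (q j \<bullet> y))"
  using assms
proof (induction k)
  case 0
  show ?case by (intro bexI[of _ "0\<^sub>v n"]) auto
next
  case (Suc k)
  then obtain a where a: "a \<in> carrier_vec n" "\<forall>y\<in>carrier_vec n. a \<bullet> y = (\<Sum>j<k. g j * (q j \<bullet> y))" by force
  have q: "q k \<in> carrier_vec n" using Suc.prems by simp
  show ?case
    using a q by (intro bexI[of _ "a + g k \<cdot>\<^sub>v q k"]) (auto simp: add_scalar_prod_distrib[of _ n])
qed

text \<open>Invertibility upgrades a positive semidefinite form to a positive definite one.\<close>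

locale psd_mat =
  fixes n :: nat and S :: "real mat"
  assumes S: "S \<in> carrier_mat n n" and sym: "transpose_mat S = S"
    and psd: "\<And>a. a \<in> carrier_vec n \<Longrightarrow> a \<bullet> (S *\<^sub>v a) \<ge> 0"
    and inv: "invertible_mat S"
begin

lemma form_carrier: "v \<in> carrier_vec n \<Longrightarrow> S *\<^sub>v v \<in> carrier_vec n"
  using S by simp

lemma form_shift: "x \<in> carrier_vec n \<Longrightarrow> y \<in> carrier_vec n \<Longrightarrow> y \<bullet> (S *\<^sub>v x) = (S *\<^sub>v y) \<bullet> x"
  using mult_mat_vec_scalar_prod_shift[OF S] sym by simp

lemma form_sym: "x \<in> carrier_vec n \<Longrightarrow> y \<in> carrier_vec n \<Longrightarrow> y \<bullet> (S *\<^sub>v x) = x \<bullet> (S *\<^sub>v y)"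
  using form_shift[of x y] comm_scalar_prod[OF form_carrier, of y x] by metis

text \<open>If \<open>v \<bullet> S v = 0\<close> with \<open>b = S v \<noteq> 0\<close>, then the form would be negative at \<open>v + t b\<close> for small
  negative \<open>t\<close>, because its linear term in \<open>t\<close> is \<open>2 t (b \<bullet> b)\<close>.\<close>

lemma positive:
  assumes v: "v \<in> carrier_vec n" and "v \<noteq> 0\<^sub>v n"
  shows "v \<bullet> (S *\<^sub>v v) > 0"
proof (rule ccontr)
  assume "\<not> ?thesis"
  with psd[OF v] have v0: "v \<bullet> (S *\<^sub>v v) = 0" by linarith
  define b where "b = S *\<^sub>v v"
  have b: "b \<in> carrier_vec n" unfolding b_def by (rule form_carrier[OF v])
  have "b \<noteq> 0\<^sub>v n"
    using invertible_mat_det[OF S inv] det_0_iff_vec_prod_zero[OF S] assms unfolding b_def by blast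
  then have q: "b \<bullet> b > 0" using scalar_prod_self_pos[OF b] by simp
  let ?c = "b \<bullet> (S *\<^sub>v b)"
  have c: "?c \<ge> 0" by (rule psd[OF b])
  define d where "d = ?c + 1"
  have d: "d > 0" "?c < d" using c by (auto simp: d_def)
  \<comment> \<open>any small enough negative multiple works; the shift by one keeps the denominator positive\<close>
  define t where "t = - (b \<bullet> b) / d"
  have tb: "t \<cdot>\<^sub>v b \<in> carrier_vec n" using b by simp
  have Stb: "S *\<^sub>v (v + t \<cdot>\<^sub>v b) = b + t \<cdot>\<^sub>v (S *\<^sub>v b)"
    using v b S tb by (simp add: mult_add_distrib_mat_vec[OF S v tb] mult_mat_vec[OF S b] b_def[symmetric])
  have vSb: "v \<bullet> (S *\<^sub>v b) = b \<bullet> b" using form_shift[OF b v] by (simp add: b_def)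
  have vb: "v \<bullet> b = 0" using v0 by (simp add: b_def)
  have "0 \<le> (v + t \<cdot>\<^sub>v b) \<bullet> (S *\<^sub>v (v + t \<cdot>\<^sub>v b))" by (rule psd) (use v b in simp)
  also have "\<dots> = 2 * t * (b \<bullet> b) + t\<^sup>2 * ?c"
    unfolding Stb using v b form_carrier[OF b]
    by (simp add: add_scalar_prod_distrib[of _ n] scalar_prod_add_distrib[of _ n] vb vSb power2_eq_square)
  also have "\<dots> = (b \<bullet> b)\<^sup>2 / d * (?c / d - 2)"
    unfolding t_def using d by (simp add: field_simps power2_eq_square)
  also have "\<dots> < 0"
    using q d by (intro mult_pos_neg) (auto simp: field_simps)
  finally show False by simp
qed

text \<open>Gram-Schmidt by dimension count: fewer than \<open>n\<close> orthogonality conditions leave a nonzero solution.\<close>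

lemma exists_orthonormal:
  "k \<le> n \<Longrightarrow> \<exists>q. (\<forall>i<k. q i \<in> carrier_vec n) \<and> (\<forall>i<k. \<forall>j<k. q i \<bullet> (S *\<^sub>v q j) = (if i = j then 1 else 0))"
proof (induction k)
  case (Suc k)
  then obtain q where q: "\<And>i. i < k \<Longrightarrow> q i \<in> carrier_vec n"
    and on: "\<And>i j. i < k \<Longrightarrow> j < k \<Longrightarrow> q i \<bullet> (S *\<^sub>v q j) = (if i = j then 1 else 0)"
    by auto
  \<comment> \<open>row \<open>k\<close> of this matrix of conditions is zero, hence it is singular\<close>
  define A where "A = mat n n (\<lambda>(i, j). if i < k then (S *\<^sub>v q i) $ j else 0)"
  have A: "A \<in> carrier_mat n n" by (simp add: A_def)
  have "transpose_mat A *\<^sub>v unit_vec n k = 0\<^sub>v n"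
    using Suc.prems by (intro eq_vecI) (auto simp: A_def)
  moreover have "unit_vec n k \<noteq> (0\<^sub>v n :: real vec)"
    using Suc.prems by simp
  ultimately have "det (transpose_mat A) = 0"
    using A by (subst det_0_iff_vec_prod_zero[of _ n]) (auto intro!: exI[of _ "unit_vec n k"])
  then have "det A = 0" by (simp add: det_transpose[OF A])
  then obtain v where v: "v \<in> carrier_vec n" "v \<noteq> 0\<^sub>v n" "A *\<^sub>v v = 0\<^sub>v n"
    using det_0_iff_vec_prod_zero[OF A] by auto
  have orth: "q i \<bullet> (S *\<^sub>v v) = 0" if "i < k" for i
  proof -
    have i: "i < n" using that Suc.prems by simp
    have "row A i = S *\<^sub>v q i"
      using i that S by (intro eq_vecI) (auto simp: A_def)
    then have "(S *\<^sub>v q i) \<bullet> v = (A *\<^sub>v v) $ i" using i A by simp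
    then show ?thesis using form_shift[OF v(1) q[OF that]] i v(3) by simp
  qed
  define z where "z = (1 / sqrt (v \<bullet> (S *\<^sub>v v))) \<cdot>\<^sub>v v"
  have z: "z \<in> carrier_vec n" using v by (simp add: z_def)
  have p: "v \<bullet> (S *\<^sub>v v) > 0" by (rule positive[OF v(1,2)])
  have Sz: "S *\<^sub>v z = (1 / sqrt (v \<bullet> (S *\<^sub>v v))) \<cdot>\<^sub>v (S *\<^sub>v v)"
    unfolding z_def by (rule mult_mat_vec[OF S v(1)])
  have zz: "z \<bullet> (S *\<^sub>v z) = 1"
    unfolding Sz unfolding z_def using v form_carrier[OF v(1)] p by (simp add: field_simps)
  have qz: "q i \<bullet> (S *\<^sub>v z) = 0" if "i < k" for i
    unfolding Sz using q[OF that] form_carrier[OF v(1)] orth[OF that] by simp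
  then have zq: "z \<bullet> (S *\<^sub>v q i) = 0" if "i < k" for i
    using form_sym[OF q[OF that] z] that by simp
  show ?case
    by (intro exI[of _ "q(k := z)"]) (use q z on zz qz zq in \<open>auto simp: less_Suc_eq\<close>)
qed auto

text \<open>With the \<open>q j\<close> as columns of \<open>Q\<close>, orthonormality says \<open>Q\<^sup>T S Q = 1\<close>, whence \<open>Q Q\<^sup>T\<close> is the inverse
  of \<open>S\<close>. In these coordinates the test statistic is a plain sum of squares.\<close>

lemma whitening:
  obtains q where "\<And>j. j < n \<Longrightarrow> q j \<in> carrier_vec n"
    "\<And>i j. i < n \<Longrightarrow> j < n \<Longrightarrow> q i \<bullet> (S *\<^sub>v q j) = (if i = j then 1 else 0)"
    "\<And>y. y \<in> carrier_vec n \<Longrightarrow> inv_quad S y = (\<Sum>j<n. (q j \<bullet> y)\<^sup>2)"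
proof -
  obtain q where q: "\<And>i. i < n \<Longrightarrow> q i \<in> carrier_vec n"
    and on: "\<And>i j. i < n \<Longrightarrow> j < n \<Longrightarrow> q i \<bullet> (S *\<^sub>v q j) = (if i = j then 1 else 0)"
    using exists_orthonormal[of n] by auto
  define Q where "Q = mat n n (\<lambda>(i, j). q j $ i)"
  have Q: "Q \<in> carrier_mat n n" by (simp add: Q_def)
  have tQ: "transpose_mat Q \<in> carrier_mat n n" using Q by simp
  have SQ: "S * Q \<in> carrier_mat n n" using S Q by simp
  have col: "col Q j = q j" if "j < n" for j
    using q[OF that] that by (intro eq_vecI) (auto simp: Q_def)
  have "transpose_mat Q * (S * Q) = 1\<^sub>m n"
  proof (rule eq_matI)
    fix i j assume ij: "i < dim_row (1\<^sub>m n :: real mat)" "j < dim_col (1\<^sub>m n :: real mat)"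
    then have "(transpose_mat Q * (S * Q)) $$ (i, j) = col Q i \<bullet> col (S * Q) j"
      using Q S by simp
    also have "col (S * Q) j = S *\<^sub>v q j"
      using col_mult2[OF S Q, of j] ij col[of j] by simp
    finally show "(transpose_mat Q * (S * Q)) $$ (i, j) = 1\<^sub>m n $$ (i, j)"
      using ij by (simp add: col on)
  qed (use Q S in auto)
  from mat_mult_left_right_inverse[OF tQ SQ this]
  have "S * (Q * transpose_mat Q) = 1\<^sub>m n"
    using assoc_mult_mat[OF S Q tQ] by simp
  then have inv_S: "mat_inv S = Q * transpose_mat Q"
    by (intro mat_inv_eq[OF S]) (use Q tQ in auto)
  have "inv_quad S y = (\<Sum>j<n. (q j \<bullet> y)\<^sup>2)" if y: "y \<in> carrier_vec n" for y
  proof -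
    have ty: "transpose_mat Q *\<^sub>v y \<in> carrier_vec n" using tQ y by simp
    have "inv_quad S y = y \<bullet> (Q *\<^sub>v (transpose_mat Q *\<^sub>v y))"
      unfolding inv_quad_def inv_S using assoc_mult_mat_vec[OF Q tQ y] by simp
    also have "\<dots> = (transpose_mat Q *\<^sub>v y) \<bullet> (transpose_mat Q *\<^sub>v y)"
      by (rule mult_mat_vec_scalar_prod_shift[OF Q ty y])
    also have "\<dots> = (\<Sum>j<n. (q j \<bullet> y)\<^sup>2)"
      using Q by (auto simp: scalar_prod_def[of "transpose_mat Q *\<^sub>v y"] col power2_eq_square atLeast0LessThan intro!: sum.cong)
    finally show ?thesis .
  qed
  with that q on show thesis by blast
qed

lemma rank: "mat_rank S = n"
  using invertible_mat_det[OF S inv] vec_space.det_rank_iff[OF S] S by (simp add: mat_rank_def)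

end

section \<open>Exponential moments and a tail bound\<close>

lemma nn_integral_normal_density: "\<sigma> > 0 \<Longrightarrow> (\<integral>\<^sup>+x. ennreal (normal_density \<mu> \<sigma> x) \<partial>lborel) = 1"
  by (simp add: nn_integral_eq_integral integrable_normal_density integral_normal_density)

text \<open>Completing the square: the exponential factor shifts the mean by \<open>\<sigma>\<^sup>2\<close>.\<close>

lemma nn_integral_exp_normal_density:
  assumes "\<sigma> > 0"
  shows "(\<integral>\<^sup>+x. ennreal (normal_density \<mu> \<sigma> x) * ennreal (exp x) \<partial>lborel) = ennreal (exp (\<mu> + \<sigma>\<^sup>2 / 2))"
proof -
  have "normal_density \<mu> \<sigma> x * exp x = exp (\<mu> + \<sigma>\<^sup>2 / 2) * normal_density (\<mu> + \<sigma>\<^sup>2) \<sigma> x" for x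
  proof -
    have "- (x - \<mu>)\<^sup>2 / (2 * \<sigma>\<^sup>2) + x = (\<mu> + \<sigma>\<^sup>2 / 2) + - (x - (\<mu> + \<sigma>\<^sup>2))\<^sup>2 / (2 * \<sigma>\<^sup>2)"
      using assms by (simp add: field_simps power2_eq_square)
    then have "exp (- (x - \<mu>)\<^sup>2 / (2 * \<sigma>\<^sup>2)) * exp x = exp (\<mu> + \<sigma>\<^sup>2 / 2) * exp (- (x - (\<mu> + \<sigma>\<^sup>2))\<^sup>2 / (2 * \<sigma>\<^sup>2))"
      by (simp only: exp_add[symmetric])
    then show ?thesis by (simp add: normal_density_def)
  qed
  then have "(\<integral>\<^sup>+x. ennreal (normal_density \<mu> \<sigma> x) * ennreal (exp x) \<partial>lborel)
    = (\<integral>\<^sup>+x. ennreal (exp (\<mu> + \<sigma>\<^sup>2 / 2)) * ennreal (normal_density (\<mu> + \<sigma>\<^sup>2) \<sigma> x) \<partial>lborel)"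
    by (simp add: ennreal_mult[symmetric])
  then show ?thesis
    using assms by (simp add: nn_integral_cmult nn_integral_normal_density)
qed

text \<open>Completing the square again, now with a quadratic exponent that rescales the variance to
  \<open>1 / (1 - 2 s)\<close>.\<close>

lemma nn_integral_exp_quadratic_std_normal:
  assumes s: "s < 1 / 2"
  shows "(\<integral>\<^sup>+x. ennreal (std_normal_density x) * ennreal (exp (a * x + s * x\<^sup>2)) \<partial>lborel)
    = ennreal (1 / sqrt (1 - 2 * s) * exp (a\<^sup>2 / (2 * (1 - 2 * s))))"
proof -
  define d where "d = 1 - 2 * s"
  have d: "d > 0" using s by (simp add: d_def)
  have s_eq: "s = (1 - d) / 2" by (simp add: d_def)
  let ?K = "1 / sqrt d * exp (a\<^sup>2 / (2 * d))"
  have "std_normal_density x * exp (a * x + s * x\<^sup>2) = ?K * normal_density (a / d) (1 / sqrt d) x" for x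
  proof -
    have "- x\<^sup>2 / 2 + (a * x + s * x\<^sup>2) = a\<^sup>2 / (2 * d) + - (x - a / d)\<^sup>2 * d / 2"
      unfolding s_eq using d by (simp add: field_simps power2_eq_square)
    then have e: "exp (- x\<^sup>2 / 2) * exp (a * x + s * x\<^sup>2) = exp (a\<^sup>2 / (2 * d)) * exp (- (x - a / d)\<^sup>2 * d / 2)"
      by (simp only: exp_add[symmetric])
    have "normal_density (a / d) (1 / sqrt d) x = sqrt d / sqrt (2 * pi) * exp (- (x - a / d)\<^sup>2 * d / 2)"
      using d by (simp add: normal_density_def power_divide real_sqrt_divide)
    then show ?thesis
      using e d by (simp add: std_normal_density_def)
  qed
  then have "(\<integral>\<^sup>+x. ennreal (std_normal_density x) * ennreal (exp (a * x + s * x\<^sup>2)) \<partial>lborel)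
    = (\<integral>\<^sup>+x. ennreal ?K * ennreal (normal_density (a / d) (1 / sqrt d) x) \<partial>lborel)"
    using d by (simp add: ennreal_mult[symmetric])
  also have "\<dots> = ennreal ?K"
    using d by (simp add: nn_integral_cmult nn_integral_normal_density)
  finally show ?thesis by (simp add: d_def)
qed

lemma (in prob_space) has_normal_law_exp:
  assumes "has_normal_law M X m s"
  shows "s \<ge> 0" "X \<in> borel_measurable M" "(\<integral>\<^sup>+\<omega>. ennreal (exp (X \<omega>)) \<partial>M) = ennreal (exp (m + s / 2))"
proof -
  consider "s = 0" "X \<in> borel_measurable M" "AE \<omega> in M. X \<omega> = m"
    | "s > 0" "distributed M lborel X (normal_density m (sqrt s))"
    using assms by (auto simp: has_normal_law_def split: if_splits)
  then have "s \<ge> 0 \<and> X \<in> borel_measurable M \<and> (\<integral>\<^sup>+\<omega>. ennreal (exp (X \<omega>)) \<partial>M) = ennreal (exp (m + s / 2))"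
  proof cases
    case 1
    then have "(\<integral>\<^sup>+\<omega>. ennreal (exp (X \<omega>)) \<partial>M) = (\<integral>\<^sup>+\<omega>. ennreal (exp m) \<partial>M)"
      by (intro nn_integral_cong_AE) auto
    then show ?thesis using 1 by (simp add: emeasure_space_1)
  next
    case 2
    then have "(\<integral>\<^sup>+\<omega>. ennreal (exp (X \<omega>)) \<partial>M) = (\<integral>\<^sup>+x. ennreal (normal_density m (sqrt s) x) * ennreal (exp x) \<partial>lborel)"
      by (subst distributed_nn_integral[OF 2(2), symmetric]) auto
    then show ?thesis
      using 2 distributed_measurable[OF 2(2)] by (simp add: nn_integral_exp_normal_density)
  qed
  then show "s \<ge> 0" "X \<in> borel_measurable M" "(\<integral>\<^sup>+\<omega>. ennreal (exp (X \<omega>)) \<partial>M) = ennreal (exp (m + s / 2))"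
    by auto
qed

text \<open>A variable bounded above by \<open>C\<close> has \<open>E exp (g Z) \<le> exp (g C)\<close> for \<open>g > 0\<close>, which contradicts the
  quadratic growth of the exponent in \<open>g\<close>.\<close>

lemma (in prob_space) prob_large_pos:
  fixes Z :: "'a \<Rightarrow> real"
  assumes [measurable]: "Z \<in> borel_measurable M"
    and mgf: "\<And>g. (\<integral>\<^sup>+\<omega>. ennreal (exp (g * Z \<omega>)) \<partial>M) = ennreal (exp (g * m + g\<^sup>2 / 2))"
  shows "prob {\<omega> \<in> space M. Z \<omega> \<ge> C} > 0"
proof (rule ccontr)
  assume "\<not> ?thesis"
  then have "prob {\<omega> \<in> space M. Z \<omega> \<ge> C} = 0" by (simp add: zero_less_measure_iff)
  then have ae: "AE \<omega> in M. \<not> Z \<omega> \<ge> C" by (subst (asm) prob_eq_0) auto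
  obtain g where "g > max 0 (2 * (C - m))" using gt_ex by blast
  then have g: "g > 0" "g > 2 * (C - m)" by simp_all
  have "(\<integral>\<^sup>+\<omega>. ennreal (exp (g * Z \<omega>)) \<partial>M) \<le> (\<integral>\<^sup>+\<omega>. ennreal (exp (g * C)) \<partial>M)"
  proof (rule nn_integral_mono_AE)
    show "AE \<omega> in M. ennreal (exp (g * Z \<omega>)) \<le> ennreal (exp (g * C))"
      using ae
    proof eventually_elim
      case (elim \<omega>)
      then have "g * Z \<omega> \<le> g * C" using g(1) by (intro mult_left_mono) auto
      then show ?case by (intro ennreal_leI) simp
    qed
  qed
  then have "ennreal (exp (g * m + g\<^sup>2 / 2)) \<le> ennreal (exp (g * C))"
    by (simp only: mgf nn_integral_const emeasure_space_1 mult_1_right)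
  then have "g * m + g * (g / 2) \<le> g * C"
    by (simp add: power2_eq_square)
  then have "g * (m + g / 2) \<le> g * C" by (simp add: algebra_simps)
  then have "m + g / 2 \<le> C" using g(1) by simp
  then show False using g(2) by simp
qed

text \<open>The moments of the squares are reduced to those of linear combinations with the help of auxiliary
  independent standard normal variables \<open>x j\<close>: the average of \<open>exp (sqrt (2 s) x z)\<close> over \<open>x\<close> is
  \<open>exp (s z\<^sup>2)\<close>, and after exchanging the two integrals the hypothesis applies for every fixed \<open>x\<close>.\<close>

lemma (in prob_space) nn_integral_exp_sum_squares:
  fixes Z :: "nat \<Rightarrow> 'a \<Rightarrow> real"
  assumes Z[measurable]: "\<And>j. j < n \<Longrightarrow> Z j \<in> borel_measurable M"
    and mgf: "\<And>g. (\<integral>\<^sup>+\<omega>. ennreal (exp (\<Sum>j<n. g j * Z j \<omega>)) \<partial>M) = ennreal (exp (\<Sum>j<n. g j * \<mu> j + (g j)\<^sup>2 / 2))"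
    and s: "0 \<le> s" "s < 1 / 2"
  shows "(\<integral>\<^sup>+\<omega>. ennreal (exp (s * (\<Sum>j<n. (Z j \<omega>)\<^sup>2))) \<partial>M)
    = ennreal (\<Prod>j<n. 1 / sqrt (1 - 2 * s) * exp (s * (\<mu> j)\<^sup>2 / (1 - 2 * s)))"
proof -
  define D where "D = density lborel (\<lambda>x. ennreal (std_normal_density x))"
  interpret D: prob_space D unfolding D_def by (rule prob_space_normal_density) simp
  have sets_D[measurable_cong]: "sets D = sets borel" by (simp add: D_def)
  interpret P: product_prob_space "\<lambda>_::nat. D" "{..<n}" by unfold_locales
  let ?G = "PiM {..<n} (\<lambda>_. D)"
  interpret G: prob_space ?G by (rule prob_space_PiM) unfold_locales
  interpret pair_sigma_finite M ?G by unfold_locales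
  define c where "c = sqrt (2 * s)"
  have c2: "c\<^sup>2 = 2 * s" using s by (simp add: c_def)
  have int_D: "(\<integral>\<^sup>+x. f x \<partial>D) = (\<integral>\<^sup>+x. ennreal (std_normal_density x) * f x \<partial>lborel)"
    if "f \<in> borel_measurable borel" for f
    unfolding D_def using that by (subst nn_integral_density) auto
  have lin: "(\<integral>\<^sup>+x. ennreal (exp (c * x * z)) \<partial>D) = ennreal (exp (s * z\<^sup>2))" for z
    using nn_integral_exp_quadratic_std_normal[of 0 "c * z"] c2
    by (simp add: int_D power_mult_distrib mult_ac)
  have quad: "(\<integral>\<^sup>+x. ennreal (exp (c * x * m + (c * x)\<^sup>2 / 2)) \<partial>D)
      = ennreal (1 / sqrt (1 - 2 * s) * exp (s * m\<^sup>2 / (1 - 2 * s)))" for m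
  proof -
    have e1: "(c * m)\<^sup>2 / (2 * (1 - 2 * s)) = s * m\<^sup>2 / (1 - 2 * s)"
      using mult_divide_mult_cancel_left[of 2 "s * m\<^sup>2" "1 - 2 * s"] unfolding power_mult_distrib c2 by (simp only: mult.assoc)
    have e2: "c * x * m + (c * x)\<^sup>2 / 2 = (c * m) * x + s * x\<^sup>2" for x
      unfolding power_mult_distrib c2 by simp
    have "(\<integral>\<^sup>+x. ennreal (exp (c * x * m + (c * x)\<^sup>2 / 2)) \<partial>D)
      = (\<integral>\<^sup>+x. ennreal (std_normal_density x) * ennreal (exp ((c * m) * x + s * x\<^sup>2)) \<partial>lborel)"
      unfolding e2 by (rule int_D) measurable
    also have "\<dots> = ennreal (1 / sqrt (1 - 2 * s) * exp (s * m\<^sup>2 / (1 - 2 * s)))"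
      unfolding nn_integral_exp_quadratic_std_normal[OF s(2)] e1 ..
    finally show ?thesis .
  qed
  have prod: "(\<integral>\<^sup>+x. (\<Prod>j<n. ennreal (f j (x j))) \<partial>?G) = (\<Prod>j<n. \<integral>\<^sup>+x. ennreal (f j x) \<partial>D)"
    if "\<And>j. f j \<in> borel_measurable borel" for f :: "nat \<Rightarrow> real \<Rightarrow> real"
  proof (rule P.product_nn_integral_prod)
    fix j
    have "f j \<in> borel_measurable D" using that[of j] measurable_cong_sets[OF sets_D refl] by blast
    then show "(\<lambda>x. ennreal (f j x)) \<in> borel_measurable D" by (rule measurable_compose) simp
  qed simp
  have exp_sum: "ennreal (exp (\<Sum>j<n. f j)) = (\<Prod>j<n. ennreal (exp (f j)))" for f :: "nat \<Rightarrow> real"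
    by (subst prod_ennreal) (simp_all add: exp_sum)
  have "(\<integral>\<^sup>+\<omega>. ennreal (exp (s * (\<Sum>j<n. (Z j \<omega>)\<^sup>2))) \<partial>M) = (\<integral>\<^sup>+\<omega>. (\<integral>\<^sup>+x. ennreal (exp (\<Sum>j<n. c * x j * Z j \<omega>)) \<partial>?G) \<partial>M)"
  proof (rule nn_integral_cong)
    fix \<omega>
    have "(\<integral>\<^sup>+x. ennreal (exp (\<Sum>j<n. c * x j * Z j \<omega>)) \<partial>?G) = (\<Prod>j<n. ennreal (exp (s * (Z j \<omega>)\<^sup>2)))"
      unfolding exp_sum by (subst prod) (measurable, simp only: lin)
    moreover have "ennreal (exp (s * (\<Sum>j<n. (Z j \<omega>)\<^sup>2))) = (\<Prod>j<n. ennreal (exp (s * (Z j \<omega>)\<^sup>2)))"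
      unfolding sum_distrib_left by (rule exp_sum)
    ultimately show "ennreal (exp (s * (\<Sum>j<n. (Z j \<omega>)\<^sup>2))) = (\<integral>\<^sup>+x. ennreal (exp (\<Sum>j<n. c * x j * Z j \<omega>)) \<partial>?G)"
      by (simp only:)
  qed
  also have "\<dots> = (\<integral>\<^sup>+x. (\<integral>\<^sup>+\<omega>. ennreal (exp (\<Sum>j<n. c * x j * Z j \<omega>)) \<partial>M) \<partial>?G)"
    by (rule Fubini'[symmetric]) measurable
  also have "\<dots> = (\<integral>\<^sup>+x. (\<Prod>j<n. ennreal (exp (c * x j * \<mu> j + (c * x j)\<^sup>2 / 2))) \<partial>?G)"
  proof (rule nn_integral_cong)
    fix x
    show "(\<integral>\<^sup>+\<omega>. ennreal (exp (\<Sum>j<n. c * x j * Z j \<omega>)) \<partial>M) = (\<Prod>j<n. ennreal (exp (c * x j * \<mu> j + (c * x j)\<^sup>2 / 2)))"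
      unfolding exp_sum[symmetric] by (rule mgf)
  qed
  also have "\<dots> = (\<Prod>j<n. ennreal (1 / sqrt (1 - 2 * s) * exp (s * (\<mu> j)\<^sup>2 / (1 - 2 * s))))"
    by (subst prod) (measurable, simp only: quad)
  also have "\<dots> = ennreal (\<Prod>j<n. 1 / sqrt (1 - 2 * s) * exp (s * (\<mu> j)\<^sup>2 / (1 - 2 * s)))"
    using s by (intro prod_ennreal) auto
  finally show ?thesis .
qed

text \<open>This is \<open>u \<le> sinh u\<close> at \<open>u = ln y\<close>.\<close>

lemma inverse_sqrt_exp_bound:
  assumes "y \<ge> (1::real)"
  shows "sqrt y \<le> exp ((y - 1 / y) / 4)"
proof -
  have "ln y \<le> (exp (ln y) - inverse (exp (ln y))) / 2"
    using assms by (intro real_le_x_sinh) simp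
  then have "ln y / 2 \<le> (y - 1 / y) / 4" using assms by (simp add: inverse_eq_divide)
  then have "exp (ln y / 2) \<le> exp ((y - 1 / y) / 4)" by simp
  also have "exp (ln y / 2) = sqrt y"
    using assms by (simp add: powr_half_sqrt[symmetric] powr_def)
  finally show ?thesis .
qed

text \<open>Birge's tail bound for the noncentral chi-squared law, by the exponential Markov inequality.\<close>

lemma (in prob_space) sum_squares_tail:
  fixes Z :: "nat \<Rightarrow> 'a \<Rightarrow> real"
  assumes Z[measurable]: "\<And>j. j < n \<Longrightarrow> Z j \<in> borel_measurable M"
    and mgf: "\<And>g. (\<integral>\<^sup>+\<omega>. ennreal (exp (\<Sum>j<n. g j * Z j \<omega>)) \<partial>M) = ennreal (exp (\<Sum>j<n. g j * \<mu> j + (g j)\<^sup>2 / 2))"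
    and n: "n > 0" and t: "t \<ge> 0" and l: "l = (\<Sum>j<n. (\<mu> j)\<^sup>2)"
    and \<tau>: "\<tau> \<ge> real n + l + sqrt (4 * (real n + 2 * l) * t) + 2 * t"
  shows "prob {\<omega> \<in> space M. (\<Sum>j<n. (Z j \<omega>)\<^sup>2) \<ge> \<tau>} \<le> exp (- t)"
proof -
  define V where "V = real n + 2 * l"
  have l0: "l \<ge> 0" unfolding l by (intro sum_nonneg) auto
  then have V: "V > 0" using n by (simp add: V_def)
  \<comment> \<open>\<open>s = u / (1 + 2 u)\<close> optimizes the exponent; in terms of \<open>u\<close> the square root in the threshold is \<open>2 V u\<close>\<close>
  define u where "u = sqrt (t / V)"
  have u: "u \<ge> 0" and tV: "t = V * u\<^sup>2" using t V by (auto simp: u_def)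
  define q where "q = 1 + 2 * u"
  have q: "q > 0" "q \<ge> 1" using u by (auto simp: q_def)
  define s where "s = u / q"
  have s: "0 \<le> s" "s < 1 / 2" using u q by (auto simp: s_def q_def divide_less_eq)
  have s1: "1 - 2 * s = 1 / q" using q by (simp add: s_def q_def field_simps)
  have su: "s / (1 - 2 * s) = u" unfolding s1 using q by (simp add: s_def)
  have "sqrt (4 * V * t) = 2 * V * u"
    unfolding tV using V u by (simp add: real_sqrt_mult power2_eq_square)
  then have \<tau>': "\<tau> \<ge> real n + l + 2 * V * u + 2 * V * u\<^sup>2" using \<tau> by (simp add: V_def[symmetric] tV mult.assoc)
  define X where "X = real n + l + 2 * V * u + 2 * V * u\<^sup>2"
  have expo: "- s * X + (real n * ((q - 1 / q) / 4) + u * l) = - t"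
  proof -
    have "q * (real n * ((q - 1 / q) / 4) + u * l + t) = real n * (q\<^sup>2 - 1) / 4 + q * (u * l) + q * t"
      using q by (simp add: field_simps power2_eq_square)
    also have "\<dots> = u * X"
      unfolding tV X_def q_def V_def by (simp add: algebra_simps power2_eq_square)
    also have "\<dots> = q * (s * X)"
      using q by (simp add: s_def)
    finally have "s * X = real n * ((q - 1 / q) / 4) + u * l + t"
      using q(1) mult_left_cancel[of q] by (metis less_irrefl)
    then show ?thesis by linarith
  qed
  let ?A = "{\<omega> \<in> space M. (\<Sum>j<n. (Z j \<omega>)\<^sup>2) \<ge> \<tau>}"
  have "emeasure M ?A = (\<integral>\<^sup>+\<omega>. indicator ?A \<omega> \<partial>M)" by simp
  also have "\<dots> \<le> (\<integral>\<^sup>+\<omega>. ennreal (exp (- s * \<tau>)) * ennreal (exp (s * (\<Sum>j<n. (Z j \<omega>)\<^sup>2))) \<partial>M)"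
  proof (rule nn_integral_mono)
    fix \<omega>
    show "indicator ?A \<omega> \<le> ennreal (exp (- s * \<tau>)) * ennreal (exp (s * (\<Sum>j<n. (Z j \<omega>)\<^sup>2)))"
    proof (cases "\<omega> \<in> ?A")
      case True
      then have "0 \<le> s * ((\<Sum>j<n. (Z j \<omega>)\<^sup>2) - \<tau>)" using s by simp
      moreover have "- s * \<tau> + s * (\<Sum>j<n. (Z j \<omega>)\<^sup>2) = s * ((\<Sum>j<n. (Z j \<omega>)\<^sup>2) - \<tau>)"
        by (simp only: right_diff_distrib)
      ultimately have "1 \<le> exp (- s * \<tau>) * exp (s * (\<Sum>j<n. (Z j \<omega>)\<^sup>2))"
        by (simp only: exp_add[symmetric] one_le_exp_iff)
      then show ?thesis using True by (simp add: ennreal_mult[symmetric])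
    qed simp
  qed
  also have "\<dots> = ennreal (exp (- s * \<tau>)) * ennreal (\<Prod>j<n. 1 / sqrt (1 - 2 * s) * exp (s * (\<mu> j)\<^sup>2 / (1 - 2 * s)))"
    by (subst nn_integral_cmult) (use nn_integral_exp_sum_squares[OF Z mgf s] in auto)
  also have "(\<Prod>j<n. 1 / sqrt (1 - 2 * s) * exp (s * (\<mu> j)\<^sup>2 / (1 - 2 * s))) = sqrt q ^ n * exp (u * l)"
  proof -
    have "1 / sqrt (1 - 2 * s) = sqrt q" unfolding s1 using q by (simp add: real_sqrt_divide)
    moreover have "s * (\<mu> j)\<^sup>2 / (1 - 2 * s) = u * (\<mu> j)\<^sup>2" for j
      using su by (metis times_divide_eq_left)
    ultimately show ?thesis
      by (simp add: prod.distrib exp_sum[symmetric] l sum_distrib_left)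
  qed
  also have "ennreal (exp (- s * \<tau>)) * ennreal (sqrt q ^ n * exp (u * l)) = ennreal (exp (- s * \<tau>) * (sqrt q ^ n * exp (u * l)))"
    using q by (simp add: ennreal_mult)
  also have "\<dots> \<le> ennreal (exp (- t))"
  proof (rule ennreal_leI)
    have "sqrt q ^ n \<le> exp ((q - 1 / q) / 4) ^ n"
      using q by (intro power_mono inverse_sqrt_exp_bound) auto
    also have "\<dots> = exp (real n * ((q - 1 / q) / 4))" by (rule exp_of_nat_mult[symmetric])
    finally have *: "sqrt q ^ n \<le> exp (real n * ((q - 1 / q) / 4))" .
    have "s * X \<le> s * \<tau>" using \<tau>' s(1) unfolding X_def by (rule mult_left_mono)
    then have "exp (- s * \<tau>) \<le> exp (- s * X)" by simp
    with * have "exp (- s * \<tau>) * (sqrt q ^ n * exp (u * l))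
       \<le> exp (- s * X) * (exp (real n * ((q - 1 / q) / 4)) * exp (u * l))"
      using q by (intro mult_mono) auto
    also have "\<dots> = exp (- t)" by (simp only: exp_add[symmetric] expo)
    finally show "exp (- s * \<tau>) * (sqrt q ^ n * exp (u * l)) \<le> exp (- t)" .
  qed
  finally show ?thesis by (simp add: emeasure_eq_measure)
qed

section \<open>Laws of the test statistics\<close>

text \<open>The hypothesis on the law of the noises is now used, by way of the noise vectors as elements of
  product spaces, which is the form in which their independence is expressed.\<close>

locale noisy_plant = attacked_plant M P w v ua + prob_space M
  for M :: "'w measure" and P w v ua
begin

definition all_noise :: "((nat \<times> nat) + (nat \<times> nat)) set" where
  "all_noise = ({..<nsub P} \<times> UNIV) <+> ({..<nsub P} \<times> UNIV)"

lemma noise_ix_subset: "I \<subseteq> {..<nsub P} \<Longrightarrow> noise_ix I T \<subseteq> all_noise"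
  by (auto simp: noise_ix_def all_noise_def)

definition noise_fun :: "(nat \<times> nat) + (nat \<times> nat) \<Rightarrow> 'w \<Rightarrow> nat \<Rightarrow> real" where
  "noise_fun s \<omega> = vec_fun (noise_dim P s) (noise_vec w v s \<omega>)"

definition noise_space :: "(nat \<times> nat) + (nat \<times> nat) \<Rightarrow> (nat \<Rightarrow> real) measure" where
  "noise_space s = Pi\<^sub>M {..<noise_dim P s} (\<lambda>_. borel)"

lemma noise_indep: "indep_vars noise_space noise_fun all_noise"
proof -
  have 1: "case_sum (\<lambda>(i, k). Pi\<^sub>M {..<xdim P i} (\<lambda>_. borel)) (\<lambda>(i, k). Pi\<^sub>M {..<ydim P i} (\<lambda>_. borel)) = noise_space"
    by (auto simp: fun_eq_iff noise_space_def noise_dim_def split: sum.split)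
  have 2: "case_sum (\<lambda>(i, k) \<omega>. vec_fun (xdim P i) (w i k \<omega>)) (\<lambda>(i, k) \<omega>. vec_fun (ydim P i) (v i k \<omega>)) = noise_fun"
    by (auto simp: fun_eq_iff noise_fun_def noise_dim_def noise_vec_def split: sum.split)
  show ?thesis
    using noise unfolding noise_model_def 1 2 all_noise_def by blast
qed

lemma noise_gaussian: "s \<in> all_noise \<Longrightarrow> gaussian_vec M (noise_dim P s) (noise_vec w v s) (0\<^sub>v (noise_dim P s)) (noise_cov P s)"
  using noise by (auto simp: all_noise_def noise_model_def noise_dim_def noise_vec_def noise_cov_def)

definition noise_linear :: "real vec \<Rightarrow> (nat \<Rightarrow> real) \<Rightarrow> real" where
  "noise_linear c x = (\<Sum>l<dim_vec c. c $ l * x l)"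

lemma noise_linear_eq:
  assumes "s \<in> all_noise" "\<omega> \<in> space M" "c \<in> carrier_vec (noise_dim P s)"
  shows "c \<bullet> noise_vec w v s \<omega> = noise_linear c (noise_fun s \<omega>)"
proof -
  have "noise_vec w v s \<omega> \<in> carrier_vec (noise_dim P s)"
    using noise_gaussian[OF assms(1)] assms(2) by (auto simp: gaussian_vec_def)
  then show ?thesis
    using assms(3) by (auto simp: noise_linear_def noise_fun_def vec_fun_def scalar_prod_def atLeast0LessThan intro!: sum.cong)
qed

lemma noise_linear_measurable:
  assumes "c \<in> carrier_vec (noise_dim P s)"
  shows "noise_linear c \<in> borel_measurable (noise_space s)"
proof -
  have "(\<lambda>x. x l) \<in> borel_measurable (noise_space s)" if "l < dim_vec c" for l
    using that assms unfolding noise_space_def by (intro measurable_component_singleton) auto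
  then show ?thesis unfolding noise_linear_def[abs_def] by (intro borel_measurable_sum borel_measurable_times borel_measurable_const) auto
qed

lemma noise_linear_exp:
  assumes "s \<in> all_noise" "c \<in> carrier_vec (noise_dim P s)"
  shows "c \<bullet> (noise_cov P s *\<^sub>v c) \<ge> 0"
    and "(\<integral>\<^sup>+\<omega>. ennreal (exp (noise_linear c (noise_fun s \<omega>))) \<partial>M) = ennreal (exp (c \<bullet> (noise_cov P s *\<^sub>v c) / 2))"
proof -
  have "has_normal_law M (\<lambda>\<omega>. c \<bullet> noise_vec w v s \<omega>) 0 (c \<bullet> (noise_cov P s *\<^sub>v c))"
    using noise_gaussian[OF assms(1)] assms(2) by (auto simp: gaussian_vec_def)
  note h = has_normal_law_exp[OF this]
  show "c \<bullet> (noise_cov P s *\<^sub>v c) \<ge> 0" by (rule h(1))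
  have "(\<integral>\<^sup>+\<omega>. ennreal (exp (noise_linear c (noise_fun s \<omega>))) \<partial>M) = (\<integral>\<^sup>+\<omega>. ennreal (exp (c \<bullet> noise_vec w v s \<omega>)) \<partial>M)"
    by (rule nn_integral_cong) (simp add: noise_linear_eq[OF assms(1) _ assms(2)])
  then show "(\<integral>\<^sup>+\<omega>. ennreal (exp (noise_linear c (noise_fun s \<omega>))) \<partial>M) = ennreal (exp (c \<bullet> (noise_cov P s *\<^sub>v c) / 2))"
    unfolding h(3) by simp
qed

lemma noise_fun_measurable: "s \<in> all_noise \<Longrightarrow> noise_fun s \<in> measurable M (noise_space s)"
  using noise_indep by (auto simp: indep_vars_def)

text \<open>By independence, the exponential moment of the residual factorizes into those of the single
  noises, whose exponents add up to the quadratic form of \<open>S\<close>.\<close>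

lemma residual_exp:
  assumes r: "noise_residual P w v (space M) J n r \<beta> S" and J: "finite J" "J \<subseteq> all_noise" and a: "a \<in> carrier_vec n"
  shows "(\<lambda>\<omega>. a \<bullet> r \<omega>) \<in> borel_measurable M" and "a \<bullet> (S *\<^sub>v a) \<ge> 0"
    and "(\<integral>\<^sup>+\<omega>. ennreal (exp (a \<bullet> r \<omega>)) \<partial>M) = ennreal (exp (a \<bullet> \<beta> + a \<bullet> (S *\<^sub>v a) / 2))"
proof -
  from r a obtain c where c: "\<And>s. s \<in> J \<Longrightarrow> c s \<in> carrier_vec (noise_dim P s)"
    and ar: "\<And>\<omega>. \<omega> \<in> space M \<Longrightarrow> a \<bullet> r \<omega> = a \<bullet> \<beta> + (\<Sum>s\<in>J. c s \<bullet> noise_vec w v s \<omega>)"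
    and aS: "a \<bullet> (S *\<^sub>v a) = (\<Sum>s\<in>J. c s \<bullet> (noise_cov P s *\<^sub>v c s))"
    unfolding noise_residual_def by blast
  have ar': "a \<bullet> r \<omega> = a \<bullet> \<beta> + (\<Sum>s\<in>J. noise_linear (c s) (noise_fun s \<omega>))" if "\<omega> \<in> space M" for \<omega>
    unfolding ar[OF that] using J c that by (intro arg_cong2[of _ _ _ _ "(+)"] sum.cong refl noise_linear_eq) auto
  have meas: "(\<lambda>\<omega>. noise_linear (c s) (noise_fun s \<omega>)) \<in> borel_measurable M" if "s \<in> J" for s
    by (rule measurable_compose[OF noise_fun_measurable noise_linear_measurable]) (use that J c in auto)
  have "(\<lambda>\<omega>. a \<bullet> \<beta> + (\<Sum>s\<in>J. noise_linear (c s) (noise_fun s \<omega>))) \<in> borel_measurable M"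
    using meas by (intro borel_measurable_add borel_measurable_sum borel_measurable_const)
  then show "(\<lambda>\<omega>. a \<bullet> r \<omega>) \<in> borel_measurable M"
    by (rule measurable_cong[THEN iffD2, rotated]) (rule ar')
  show "a \<bullet> (S *\<^sub>v a) \<ge> 0"
    unfolding aS using J c by (intro sum_nonneg noise_linear_exp(1)) auto
  have ind: "indep_vars (\<lambda>_. borel) (\<lambda>s \<omega>. ennreal (exp (noise_linear (c s) (noise_fun s \<omega>)))) J"
  proof (rule indep_vars_compose2[OF indep_vars_subset[OF noise_indep J(2)]])
    fix s assume "s \<in> J"
    then show "(\<lambda>x. ennreal (exp (noise_linear (c s) x))) \<in> borel_measurable (noise_space s)"
      by (intro measurable_compose[OF noise_linear_measurable[OF c]]) auto
  qed
  have "(\<integral>\<^sup>+\<omega>. ennreal (exp (a \<bullet> r \<omega>)) \<partial>M)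
    = (\<integral>\<^sup>+\<omega>. ennreal (exp (a \<bullet> \<beta>)) * (\<Prod>s\<in>J. ennreal (exp (noise_linear (c s) (noise_fun s \<omega>)))) \<partial>M)"
    by (rule nn_integral_cong) (simp add: ar' exp_add exp_sum J prod_ennreal ennreal_mult prod_nonneg)
  also have "\<dots> = ennreal (exp (a \<bullet> \<beta>)) * (\<integral>\<^sup>+\<omega>. (\<Prod>s\<in>J. ennreal (exp (noise_linear (c s) (noise_fun s \<omega>)))) \<partial>M)"
    by (rule nn_integral_cmult) (use meas in \<open>intro borel_measurable_prod_ennreal measurable_compose[OF _ measurable_ennreal] measurable_compose[OF _ borel_measurable_exp]\<close>, auto)
  also have "(\<integral>\<^sup>+\<omega>. (\<Prod>s\<in>J. ennreal (exp (noise_linear (c s) (noise_fun s \<omega>)))) \<partial>M)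
    = (\<Prod>s\<in>J. \<integral>\<^sup>+\<omega>. ennreal (exp (noise_linear (c s) (noise_fun s \<omega>))) \<partial>M)"
    by (rule indep_vars_nn_integral[OF J(1) ind]) simp
  also have "\<dots> = (\<Prod>s\<in>J. ennreal (exp (c s \<bullet> (noise_cov P s *\<^sub>v c s) / 2)))"
    using J c by (intro prod.cong refl noise_linear_exp(2)) auto
  also have "ennreal (exp (a \<bullet> \<beta>)) * \<dots> = ennreal (exp (a \<bullet> \<beta> + a \<bullet> (S *\<^sub>v a) / 2))"
    by (simp add: aS exp_add exp_sum[OF J(1)] sum_divide_distrib prod_ennreal ennreal_mult prod_nonneg)
  finally show "(\<integral>\<^sup>+\<omega>. ennreal (exp (a \<bullet> r \<omega>)) \<partial>M) = ennreal (exp (a \<bullet> \<beta> + a \<bullet> (S *\<^sub>v a) / 2))" .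
qed

lemma residual_psd:
  assumes r: "noise_residual P w v (space M) J n r \<beta> S" and J: "finite J" "J \<subseteq> all_noise" and inv: "invertible_mat S"
  shows "psd_mat n S"
  using r residual_exp(2)[OF r J] inv by unfold_locales (auto simp: noise_residual_def)

lemma whitened_residual:
  assumes r: "noise_residual P w v (space M) J n r \<beta> S" and J: "finite J" "J \<subseteq> all_noise" and inv: "invertible_mat S"
  obtains q where "\<And>j. j < n \<Longrightarrow> q j \<in> carrier_vec n"
    "\<And>y. y \<in> carrier_vec n \<Longrightarrow> inv_quad S y = (\<Sum>j<n. (q j \<bullet> y)\<^sup>2)"
    "\<And>j. j < n \<Longrightarrow> (\<lambda>\<omega>. q j \<bullet> r \<omega>) \<in> borel_measurable M"
    "\<And>g. (\<integral>\<^sup>+\<omega>. ennreal (exp (\<Sum>j<n. g j * (q j \<bullet> r \<omega>))) \<partial>M) = ennreal (exp (\<Sum>j<n. g j * (q j \<bullet> \<beta>) + (g j)\<^sup>2 / 2))"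
proof -
  interpret psd_mat n S by (rule residual_psd[OF r J inv])
  obtain q where q: "\<And>j. j < n \<Longrightarrow> q j \<in> carrier_vec n"
    and on: "\<And>i j. i < n \<Longrightarrow> j < n \<Longrightarrow> q i \<bullet> (S *\<^sub>v q j) = (if i = j then 1 else 0)"
    and wh: "\<And>y. y \<in> carrier_vec n \<Longrightarrow> inv_quad S y = (\<Sum>j<n. (q j \<bullet> y)\<^sup>2)"
    by (rule whitening) blast
  have \<beta>: "\<beta> \<in> carrier_vec n" and rc: "\<And>\<omega>. \<omega> \<in> space M \<Longrightarrow> r \<omega> \<in> carrier_vec n"
    using r by (auto simp: noise_residual_def)
  have mgf: "(\<integral>\<^sup>+\<omega>. ennreal (exp (\<Sum>j<n. g j * (q j \<bullet> r \<omega>))) \<partial>M) = ennreal (exp (\<Sum>j<n. g j * (q j \<bullet> \<beta>) + (g j)\<^sup>2 / 2))" for g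
  proof -
    obtain a where a: "a \<in> carrier_vec n" and ay: "\<And>y. y \<in> carrier_vec n \<Longrightarrow> a \<bullet> y = (\<Sum>j<n. g j * (q j \<bullet> y))"
      using exists_vec_combination[of n q n g] q by blast
    have qa: "q j \<bullet> (S *\<^sub>v a) = g j" if j: "j < n" for j
    proof -
      have "q j \<bullet> (S *\<^sub>v a) = a \<bullet> (S *\<^sub>v q j)" by (rule form_sym[OF a q[OF j]])
      also have "\<dots> = (\<Sum>i<n. g i * (if i = j then 1 else 0))"
        unfolding ay[OF form_carrier[OF q[OF j]]] using on j by (intro sum.cong) auto
      finally show ?thesis using j by (simp add: if_distrib cong: if_cong)
    qed
    have "a \<bullet> (S *\<^sub>v a) = (\<Sum>j<n. (g j)\<^sup>2)"
      unfolding ay[OF form_carrier[OF a]] using qa by (intro sum.cong) (auto simp: power2_eq_square)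
    then have "a \<bullet> \<beta> + a \<bullet> (S *\<^sub>v a) / 2 = (\<Sum>j<n. g j * (q j \<bullet> \<beta>) + (g j)\<^sup>2 / 2)"
      by (simp add: ay[OF \<beta>] sum.distrib sum_divide_distrib)
    moreover have "(\<integral>\<^sup>+\<omega>. ennreal (exp (\<Sum>j<n. g j * (q j \<bullet> r \<omega>))) \<partial>M) = (\<integral>\<^sup>+\<omega>. ennreal (exp (a \<bullet> r \<omega>)) \<partial>M)"
      by (rule nn_integral_cong) (simp add: ay[OF rc])
    ultimately show ?thesis using residual_exp(3)[OF r J a] by simp
  qed
  show thesis
    using that[of q] q wh mgf residual_exp(1)[OF r J] by blast
qed

text \<open>Independence of statistics that depend on disjoint sets of noises needs each statistic to be
  a measurable function of its noises.\<close>

lemma statistic_factor: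
  assumes r: "noise_residual P w v (space M) J n r \<beta> S" and J: "finite J" "J \<subseteq> all_noise" and inv: "invertible_mat S"
  obtains h where "h \<in> borel_measurable (Pi\<^sub>M J noise_space)"
    "\<And>\<omega>. \<omega> \<in> space M \<Longrightarrow> inv_quad S (r \<omega>) = h (\<lambda>s\<in>J. noise_fun s \<omega>)"
proof -
  obtain q where q: "\<And>j. j < n \<Longrightarrow> q j \<in> carrier_vec n"
    and wh: "\<And>y. y \<in> carrier_vec n \<Longrightarrow> inv_quad S y = (\<Sum>j<n. (q j \<bullet> y)\<^sup>2)"
    by (rule whitened_residual[OF r J inv]) blast
  have rc: "\<And>\<omega>. \<omega> \<in> space M \<Longrightarrow> r \<omega> \<in> carrier_vec n"
    using r by (auto simp: noise_residual_def)
  have "\<forall>j\<in>{..<n}. \<exists>c. (\<forall>s\<in>J. c s \<in> carrier_vec (noise_dim P s)) \<and>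
        (\<forall>\<omega>\<in>space M. q j \<bullet> r \<omega> = q j \<bullet> \<beta> + (\<Sum>s\<in>J. c s \<bullet> noise_vec w v s \<omega>))"
    using r q unfolding noise_residual_def by blast
  then obtain c where c: "\<And>j s. j < n \<Longrightarrow> s \<in> J \<Longrightarrow> c j s \<in> carrier_vec (noise_dim P s)"
    and qr: "\<And>j \<omega>. j < n \<Longrightarrow> \<omega> \<in> space M \<Longrightarrow> q j \<bullet> r \<omega> = q j \<bullet> \<beta> + (\<Sum>s\<in>J. c j s \<bullet> noise_vec w v s \<omega>)"
    unfolding bchoice_iff by auto
  define h where "h x = (\<Sum>j<n. (q j \<bullet> \<beta> + (\<Sum>s\<in>J. noise_linear (c j s) (x s)))\<^sup>2)" for x
  show thesis
  proof (rule that[of h])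
    have "(\<lambda>x. noise_linear (c j s) (x s)) \<in> borel_measurable (Pi\<^sub>M J noise_space)" if "j < n" "s \<in> J" for j s
      by (rule measurable_compose[OF measurable_component_singleton[where M = noise_space, OF that(2)] noise_linear_measurable[OF c[OF that]]])
    then show "h \<in> borel_measurable (Pi\<^sub>M J noise_space)"
      unfolding h_def[abs_def] by (intro borel_measurable_sum borel_measurable_power borel_measurable_add borel_measurable_const) auto
    fix \<omega> assume \<omega>: "\<omega> \<in> space M"
    have "q j \<bullet> r \<omega> = q j \<bullet> \<beta> + (\<Sum>s\<in>J. noise_linear (c j s) (noise_fun s \<omega>))" if "j < n" for j
      unfolding qr[OF that \<omega>] using J c that \<omega> by (intro arg_cong2[of _ _ _ _ "(+)"] sum.cong refl noise_linear_eq) auto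
    then show "inv_quad S (r \<omega>) = h (\<lambda>s\<in>J. noise_fun s \<omega>)"
      unfolding wh[OF rc[OF \<omega>]] h_def by (intro sum.cong refl) auto
  qed
qed

lemma statistic_tail:
  assumes r: "noise_residual P w v (space M) J n r \<beta> S" and J: "finite J" "J \<subseteq> all_noise" and inv: "invertible_mat S"
    and n: "n > 0" and t: "t \<ge> 0" and c: "c \<ge> real n + inv_quad S \<beta> + sqrt (4 * (real n + 2 * inv_quad S \<beta>) * t) + 2 * t"
  shows "prob {\<omega> \<in> space M. inv_quad S (r \<omega>) \<ge> c} \<le> exp (- t)"
proof -
  obtain q where q: "\<And>j. j < n \<Longrightarrow> q j \<in> carrier_vec n"
    and wh: "\<And>y. y \<in> carrier_vec n \<Longrightarrow> inv_quad S y = (\<Sum>j<n. (q j \<bullet> y)\<^sup>2)"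
    and meas: "\<And>j. j < n \<Longrightarrow> (\<lambda>\<omega>. q j \<bullet> r \<omega>) \<in> borel_measurable M"
    and mgf: "\<And>g. (\<integral>\<^sup>+\<omega>. ennreal (exp (\<Sum>j<n. g j * (q j \<bullet> r \<omega>))) \<partial>M) = ennreal (exp (\<Sum>j<n. g j * (q j \<bullet> \<beta>) + (g j)\<^sup>2 / 2))"
    by (rule whitened_residual[OF r J inv]) blast
  have \<beta>: "\<beta> \<in> carrier_vec n" and rc: "\<And>\<omega>. \<omega> \<in> space M \<Longrightarrow> r \<omega> \<in> carrier_vec n"
    using r by (auto simp: noise_residual_def)
  have "{\<omega> \<in> space M. inv_quad S (r \<omega>) \<ge> c} = {\<omega> \<in> space M. (\<Sum>j<n. (q j \<bullet> r \<omega>)\<^sup>2) \<ge> c}"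
    using wh[OF rc] by auto
  then show ?thesis
    using sum_squares_tail[of n "\<lambda>j \<omega>. q j \<bullet> r \<omega>" "\<lambda>j. q j \<bullet> \<beta>" t "inv_quad S \<beta>" c, OF meas mgf n t wh[OF \<beta>] c] by simp
qed

text \<open>One square of the whitened sum suffices to exceed any threshold.\<close>

lemma statistic_large_pos:
  assumes r: "noise_residual P w v (space M) J n r \<beta> S" and J: "finite J" "J \<subseteq> all_noise" and inv: "invertible_mat S"
    and n: "n > 0"
  shows "prob {\<omega> \<in> space M. inv_quad S (r \<omega>) \<ge> c} > 0"
proof -
  obtain q where q: "\<And>j. j < n \<Longrightarrow> q j \<in> carrier_vec n"
    and wh: "\<And>y. y \<in> carrier_vec n \<Longrightarrow> inv_quad S y = (\<Sum>j<n. (q j \<bullet> y)\<^sup>2)"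
    and meas: "\<And>j. j < n \<Longrightarrow> (\<lambda>\<omega>. q j \<bullet> r \<omega>) \<in> borel_measurable M"
    and mgf: "\<And>g. (\<integral>\<^sup>+\<omega>. ennreal (exp (\<Sum>j<n. g j * (q j \<bullet> r \<omega>))) \<partial>M) = ennreal (exp (\<Sum>j<n. g j * (q j \<bullet> \<beta>) + (g j)\<^sup>2 / 2))"
    by (rule whitened_residual[OF r J inv]) blast
  have rc: "\<And>\<omega>. \<omega> \<in> space M \<Longrightarrow> r \<omega> \<in> carrier_vec n"
    using r by (auto simp: noise_residual_def)
  let ?Z = "\<lambda>\<omega>. q 0 \<bullet> r \<omega>"
  have single: "(\<Sum>j<n. (if j = 0 then g else 0) * f j) = g * f 0" for g :: real and f
    using n by (simp add: if_distrib[of "\<lambda>x. x * _"] cong: if_cong)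
  have single': "(\<Sum>j<n. (if j = 0 then g else 0) * f j + (if j = 0 then g else 0)\<^sup>2 / 2) = g * f 0 + g\<^sup>2 / 2" for g :: real and f
    using n single[of g f] by (simp add: sum.distrib if_distrib[of "\<lambda>x. x\<^sup>2 / 2"] cong: if_cong)
  have "(\<integral>\<^sup>+\<omega>. ennreal (exp (g * ?Z \<omega>)) \<partial>M) = ennreal (exp (g * (q 0 \<bullet> \<beta>) + g\<^sup>2 / 2))" for g
    using mgf[of "\<lambda>j. if j = 0 then g else 0"] unfolding single single' .
  then have "prob {\<omega> \<in> space M. ?Z \<omega> \<ge> \<bar>c\<bar> + 1} > 0"
    by (rule prob_large_pos[OF meas[OF n]])
  also have "prob {\<omega> \<in> space M. ?Z \<omega> \<ge> \<bar>c\<bar> + 1} \<le> prob {\<omega> \<in> space M. inv_quad S (r \<omega>) \<ge> c}"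
  proof (rule finite_measure_mono)
    show "{\<omega> \<in> space M. ?Z \<omega> \<ge> \<bar>c\<bar> + 1} \<subseteq> {\<omega> \<in> space M. inv_quad S (r \<omega>) \<ge> c}"
    proof safe
      fix \<omega> assume \<omega>: "\<omega> \<in> space M" and Z: "\<bar>c\<bar> + 1 \<le> ?Z \<omega>"
      have Z1: "?Z \<omega> \<ge> 1" using Z abs_ge_zero[of c] by linarith
      have "c \<le> ?Z \<omega>" using Z abs_ge_self[of c] by linarith
      also have "\<dots> \<le> (?Z \<omega>)\<^sup>2" unfolding power2_eq_square using mult_right_mono[OF Z1, of "?Z \<omega>"] Z1 by simp
      also have "\<dots> \<le> (\<Sum>j<n. (q j \<bullet> r \<omega>)\<^sup>2)"
        using n by (intro member_le_sum[of 0 _ "\<lambda>j. (q j \<bullet> r \<omega>)\<^sup>2"]) auto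
      finally show "c \<le> inv_quad S (r \<omega>)" unfolding wh[OF rc[OF \<omega>]] .
    qed
    have [measurable]: "(\<lambda>\<omega>. \<Sum>j<n. (q j \<bullet> r \<omega>)\<^sup>2) \<in> borel_measurable M"
      using meas by (intro borel_measurable_sum borel_measurable_power) auto
    have "{\<omega> \<in> space M. inv_quad S (r \<omega>) \<ge> c} = {\<omega> \<in> space M. (\<Sum>j<n. (q j \<bullet> r \<omega>)\<^sup>2) \<ge> c}"
      using wh[OF rc] by auto
    then show "{\<omega> \<in> space M. inv_quad S (r \<omega>) \<ge> c} \<in> events" by simp
  qed
  finally show ?thesis .
qed

lemma local_statistics_indep:
  assumes r: "\<And>i. i < nsub P \<Longrightarrow> noise_residual P w v (space M) (noise_ix {i} T) (n i) (r i) (\<beta> i) (S i)"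
    and inv: "\<And>i. i < nsub P \<Longrightarrow> invertible_mat (S i)"
  shows "prob {\<omega> \<in> space M. \<exists>i<nsub P. inv_quad (S i) (r i \<omega>) \<ge> \<tau> i}
    = 1 - (\<Prod>i<nsub P. 1 - prob {\<omega> \<in> space M. inv_quad (S i) (r i \<omega>) \<ge> \<tau> i})"
proof -
  let ?J = "\<lambda>i. noise_ix {i} T"
  have "\<forall>i\<in>{..<nsub P}. \<exists>h. h \<in> borel_measurable (Pi\<^sub>M (?J i) noise_space) \<and>
      (\<forall>\<omega>\<in>space M. inv_quad (S i) (r i \<omega>) = h (\<lambda>s\<in>?J i. noise_fun s \<omega>))"
  proof
    fix i assume "i \<in> {..<nsub P}"
    then have i: "i < nsub P" by simp
    then obtain h where "h \<in> borel_measurable (Pi\<^sub>M (?J i) noise_space)"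
      "\<And>\<omega>. \<omega> \<in> space M \<Longrightarrow> inv_quad (S i) (r i \<omega>) = h (\<lambda>s\<in>?J i. noise_fun s \<omega>)"
      using statistic_factor[OF r[OF i] _ _ inv[OF i]] noise_ix_subset[of "{i}" T] by auto
    then show "\<exists>h. h \<in> borel_measurable (Pi\<^sub>M (?J i) noise_space) \<and>
      (\<forall>\<omega>\<in>space M. inv_quad (S i) (r i \<omega>) = h (\<lambda>s\<in>?J i. noise_fun s \<omega>))" by blast
  qed
  then obtain h where h: "\<And>i. i < nsub P \<Longrightarrow> h i \<in> borel_measurable (Pi\<^sub>M (?J i) noise_space)"
    "\<And>i \<omega>. i < nsub P \<Longrightarrow> \<omega> \<in> space M \<Longrightarrow> inv_quad (S i) (r i \<omega>) = h i (\<lambda>s\<in>?J i. noise_fun s \<omega>)"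
    unfolding bchoice_iff by auto
  define L where "L i \<omega> = h i (\<lambda>s\<in>?J i. noise_fun s \<omega>)" for i \<omega>
  have "indep_vars (\<lambda>i. Pi\<^sub>M (?J i) noise_space) (\<lambda>i \<omega>. \<lambda>s\<in>?J i. noise_fun s \<omega>) {..<nsub P}"
    by (rule indep_vars_restrict[OF noise_indep])
      (use noise_ix_subset in \<open>auto simp: disjoint_family_on_def noise_ix_def\<close>)
  then have ind: "indep_vars (\<lambda>_. borel) L {..<nsub P}"
    unfolding L_def[abs_def] by (rule indep_vars_compose2) (use h(1) in auto)
  have L: "L i \<in> borel_measurable M" if "i < nsub P" for i
    using ind that by (auto simp: indep_vars_def)
  have N: "{..<nsub P} \<noteq> {}" using plant by (auto simp: plant_dims_def)
  have ev: "{\<omega> \<in> space M. L i \<omega> \<ge> \<tau> i} \<in> events" if "i < nsub P" for i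
    using L[OF that] by measurable
  have alarm: "{\<omega> \<in> space M. inv_quad (S i) (r i \<omega>) \<ge> \<tau> i} = {\<omega> \<in> space M. L i \<omega> \<ge> \<tau> i}" if "i < nsub P" for i
    using h(2)[OF that] by (auto simp: L_def)
  have "prob (\<Inter>i<nsub P. L i -` {..<\<tau> i} \<inter> space M) = (\<Prod>i<nsub P. prob (L i -` {..<\<tau> i} \<inter> space M))"
    by (rule indep_varsD[OF ind N]) auto
  also have "\<dots> = (\<Prod>i<nsub P. 1 - prob {\<omega> \<in> space M. inv_quad (S i) (r i \<omega>) \<ge> \<tau> i})"
  proof (rule prod.cong[OF refl])
    fix i assume "i \<in> {..<nsub P}"
    then have i: "i < nsub P" by simp
    have "L i -` {..<\<tau> i} \<inter> space M = space M - {\<omega> \<in> space M. L i \<omega> \<ge> \<tau> i}" by auto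
    then show "prob (L i -` {..<\<tau> i} \<inter> space M) = 1 - prob {\<omega> \<in> space M. inv_quad (S i) (r i \<omega>) \<ge> \<tau> i}"
      unfolding alarm[OF i] using prob_compl[OF ev[OF i]] by simp
  qed
  finally have quiet: "prob (\<Inter>i<nsub P. L i -` {..<\<tau> i} \<inter> space M) = (\<Prod>i<nsub P. 1 - prob {\<omega> \<in> space M. inv_quad (S i) (r i \<omega>) \<ge> \<tau> i})" .
  have any: "{\<omega> \<in> space M. \<exists>i<nsub P. inv_quad (S i) (r i \<omega>) \<ge> \<tau> i} = space M - (\<Inter>i<nsub P. L i -` {..<\<tau> i} \<inter> space M)"
    using h(2) N by (auto simp: L_def not_less)
  have "(\<Inter>i<nsub P. L i -` {..<\<tau> i} \<inter> space M) \<in> events"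
    using N L by (intro sets.finite_INT) (auto intro!: measurable_sets)
  then show ?thesis
    unfolding any using prob_compl quiet by simp
qed

end

section \<open>Comparison of the detectors\<close>

theorem mainTheorem4:
  fixes M :: "'w measure" and P :: plant and T :: nat
    and w v :: "'w noise" and ua :: attack
    and NL :: "nat \<Rightarrow> real mat" and NC :: "real mat"
    and \<tau> :: "nat \<Rightarrow> real" and \<tau>c :: real
  assumes "prob_space M"
    and "plant_dims P"
    and "noise_model M P w v"
    and "attack_dims P ua"
    and "T > 0"
    and "\<And>i. i < nsub P \<Longrightarrow> left_null_nontrivial (loc_mat P T i)"
    and "\<And>i. i < nsub P \<Longrightarrow> left_null_basis (NL i) (loc_mat P T i)"
    and "left_null_nontrivial (cen_mat P T)"
    and "left_null_basis NC (cen_mat P T)"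
    and "\<And>i. i < nsub P \<Longrightarrow> invertible_mat (loc_cov P T i (NL i))"
    and "invertible_mat (cen_cov P T NC)"
    and "\<And>i. i < nsub P \<Longrightarrow> \<tau> i \<ge> 0"
    and "\<tau>c \<ge> 0"
    and "cen_alarm_prob M P T (no_attack P) w v NC \<tau>c = dec_alarm_prob M P T (no_attack P) w v NL \<tau>"
    and "let p = real (cen_dof P T NC);
             l = cen_noncentrality P T ua NC;
             t = ln (1 / (1 - (1 - min_detection_prob M P T ua w v NL \<tau>) ^ nsub P))
         in \<tau>c \<ge> p + l + sqrt (4 * (p + 2 * l) * t) + 2 * t"
  shows "dec_alarm_prob M P T ua w v NL \<tau> \<ge> cen_alarm_prob M P T ua w v NC \<tau>c"
proof -
  interpret noisy_plant M P w v ua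
    using assms(1-4) by (simp add: noisy_plant_def attacked_plant_def)
  note loc = local_residual[OF _ assms(7)]
  note cen = central_residual[OF assms(9)]
  let ?N = "nsub P" and ?p = "loc_alarm_prob M P T ua w v NL \<tau>"
  let ?pmin = "min_detection_prob M P T ua w v NL \<tau>"
  have N: "?N > 0" using assms(2) by (simp add: plant_dims_def)
  have loc_J: "finite (noise_ix {i} T)" "i < ?N \<Longrightarrow> noise_ix {i} T \<subseteq> all_noise" for i
    using noise_ix_subset[of "{i}" T] by auto
  have pmin_mem: "?pmin \<in> ?p ` {..<?N}"
    unfolding min_detection_prob_def using N by (intro Min_in) auto
  have pmin_le: "?pmin \<le> ?p i" if "i < ?N" for i
    unfolding min_detection_prob_def using that by (intro Min_le) auto
  have pos: "?p i > 0" if i: "i < ?N" for i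
    unfolding loc_alarm_prob_def loc_stat_def
    by (rule statistic_large_pos[OF loc[OF i i] loc_J(1) loc_J(2)[OF i] assms(10)[OF i] left_null_basis_nonempty[OF assms(7,6)[OF i]]])
  have le1: "?p i \<le> 1" for i
    by (simp add: loc_alarm_prob_def)
  have pmin: "0 < ?pmin" "?pmin \<le> 1" using pmin_mem pos le1 by auto
  define x where "x = 1 - (1 - ?pmin) ^ ?N"
  have x: "0 < x" "x \<le> 1"
    using pmin N by (auto simp: x_def power_less_one_iff)
  have dec: "dec_alarm_prob M P T ua w v NL \<tau> = 1 - (\<Prod>i<?N. 1 - ?p i)"
    unfolding dec_alarm_prob_def loc_alarm_prob_def loc_stat_def
    by (rule local_statistics_indep[OF loc assms(10)])
  have "(\<Prod>i<?N. 1 - ?p i) \<le> (\<Prod>i<?N. 1 - ?pmin)"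
    using pmin_le le1 by (intro prod_mono) auto
  then have x_dec: "x \<le> dec_alarm_prob M P T ua w v NL \<tau>"
    unfolding dec x_def by simp
  define t where "t = ln (1 / x)"
  have t: "t \<ge> 0" "exp (- t) = x" using x by (simp_all add: t_def ln_div)
  have cen_J: "finite (noise_ix {..<?N} T)" "noise_ix {..<?N} T \<subseteq> all_noise"
    using noise_ix_subset[of "{..<?N}" T] by auto
  interpret cen_psd: psd_mat "dim_row NC" "cen_cov P T NC"
    by (rule residual_psd[OF cen cen_J assms(11)])
  have "cen_alarm_prob M P T ua w v NC \<tau>c \<le> exp (- t)"
    unfolding cen_alarm_prob_def cen_stat_def
  proof (rule statistic_tail[OF cen cen_J assms(11) _ t(1)])
    show "dim_row NC > 0" by (rule left_null_basis_nonempty[OF assms(9,8)])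
    show "real (dim_row NC) + inv_quad (cen_cov P T NC) (cen_mean P T ua NC)
      + sqrt (4 * (real (dim_row NC) + 2 * inv_quad (cen_cov P T NC) (cen_mean P T ua NC)) * t) + 2 * t \<le> \<tau>c"
      using assms(15) unfolding Let_def cen_dof_def cen_psd.rank cen_noncentrality_def t_def x_def .
  qed
  then show ?thesis using t(2) x_dec by simp
qed

end
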